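(* Let $\epsilon>0$, let $\mathcal G:\mathscr P_2(\mathbb R^d)\to\mathbb R$ be a Lipschitz function and let $\hat{\mathcal G}^\epsilon:L^2_{\mathbb P}\to\mathbb R$ be the Lasry--Lions regularization of the lifted function $\hat{\mathcal G}:L^2_{\mathbb P}\to\mathbb R$. Then $\hat{\mathcal G}^\epsilon(X)$ only depends on $X_\#\mathbb P$. In particular, the mapping $\mathcal G^\epsilon:\mathscr P_2(\mathbb R^d)\to\mathbb R$ given by $$\mathcal G^\epsilon(\mu):=\hat{\mathcal G}^\epsilon(X),\qquad\text{where }X_\#\mathbb P=\mu,$$ is well defined. Moreover, $\mathcal G^\epsilon$ is of class $C^{1,1}$ and $$\operatorname{Lip}(\mathcal G^\epsilon)\le\operatorname{Lip}(\mathcal G),\qquad0\le\mathcal G^\epsilon-\mathcal G\le\frac{\operatorname{Lip}(\mathcal G)^2}{2}\epsilon.$$ Furthermore, if $\mathcal G$ is convex along plans, so is $\mathcal G^\epsilon$.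
   Context: $\mathscr P_2(\mathbb R^d)$ is the space of Borel probability measures on $\mathbb R^d$ with finite second moment, with the 2-Wasserstein distance; $\Gamma(\mu,\nu)$ is the set of couplings. $(\Omega,\mathbb P)$ is a fixed complete non-atomic probability space with $\Omega$ a Polish metric space, and $L^2_{\mathbb P}$ is the Hilbert space of square-integrable random variables $\Omega\to\mathbb R^d$, with norm $|\cdot|$. The lift of $\mathcal G$ is $\hat{\mathcal G}(X):=\mathcal G(X_\#\mathbb P)$. Lasry--Lions regularization of a Lipschitz $V:L^2_{\mathbb P}\to\mathbb R$: $$V^\epsilon(X):=\inf_{Z\in L^2_{\mathbb P}}\sup_{Y\in L^2_{\mathbb P}}\Big\{V(Y)-\frac1{2\epsilon}|Z-Y|^2+\frac1\epsilon|Z-X|^2\Big\}.$$ A map $\mathcal G:\mathscr P_2(\mathbb R^d)\to\mathbb R$ is of class $C^{1,1}$ if its lift is of class $C^{1,1}$ on $L^2_{\mathbb P}$ (Fréchet differentiable with Lipschitz gradient). It is convex along plans if for all $\mu,\nu$, all $\gamma\in\Gamma(\mu,\nu)$ and $t\in[0,1]$, $\mathcal G(((1-t)\pi^1+t\pi^2)_\#\gamma)\le(1-t)\mathcal G(\mu)+t\mathcal G(\nu)$. $\operatorname{Lip}$ denotes the (best) Lipschitz constant. *)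

theory Defs
  imports "HOL-Probability.Probability"
begin

definition nonatomic :: "'w measure \<Rightarrow> bool" where
  "nonatomic P \<longleftrightarrow>
     (\<forall>A\<in>sets P. 0 < emeasure P A \<longrightarrow>
        (\<exists>B\<in>sets P. B \<subseteq> A \<and> 0 < emeasure P B \<and> emeasure P B < emeasure P A))"


section \<open>The space of square-integrable random variables\<close>

text \<open>
  Elements of \<open>L\<^sup>2\<close> are represented by functions rather than by classes modulo almost-sure
  equality; accordingly \<open>L2_norm\<close> is only a seminorm on \<open>L2_space\<close>.  A function \<open>V\<close>
  on \<open>L2_space\<close> stands for a function on \<open>L\<^sup>2\<close> when it is insensitive to null sets; this holds
  for every lift, and is implied by each of the regularity notions below.
\<close>

definition L2_space :: "'w measure \<Rightarrow> ('w \<Rightarrow> 'a::euclidean_space) set" where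
  "L2_space P = {X \<in> borel_measurable P. integrable P (\<lambda>\<omega>. (norm (X \<omega>))\<^sup>2)}"

definition L2_inner :: "'w measure \<Rightarrow> ('w \<Rightarrow> 'a::euclidean_space) \<Rightarrow> ('w \<Rightarrow> 'a) \<Rightarrow> real" where
  "L2_inner P X Y = (\<integral>\<omega>. X \<omega> \<bullet> Y \<omega> \<partial>P)"

definition L2_norm :: "'w measure \<Rightarrow> ('w \<Rightarrow> 'a::euclidean_space) \<Rightarrow> real" where
  "L2_norm P X = sqrt (\<integral>\<omega>. (norm (X \<omega>))\<^sup>2 \<partial>P)"

text \<open>
  \<open>V\<close> is Frechet differentiable at \<open>X\<close> with gradient (Riesz representative of the derivative) \<open>D\<close>.
\<close>

definition has_L2_gradient ::
    "'w measure \<Rightarrow> (('w \<Rightarrow> 'a::euclidean_space) \<Rightarrow> real) \<Rightarrow> ('w \<Rightarrow> 'a) \<Rightarrow> ('w \<Rightarrow> 'a) \<Rightarrow> bool" where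
  "has_L2_gradient P V D X \<longleftrightarrow>
     D \<in> L2_space P \<and>
     (\<forall>e>0. \<exists>\<delta>>0. \<forall>Y\<in>L2_space P. L2_norm P (\<lambda>\<omega>. Y \<omega> - X \<omega>) < \<delta> \<longrightarrow>
        \<bar>V Y - V X - L2_inner P D (\<lambda>\<omega>. Y \<omega> - X \<omega>)\<bar> \<le> e * L2_norm P (\<lambda>\<omega>. Y \<omega> - X \<omega>))"

definition L2_C11 :: "'w measure \<Rightarrow> (('w \<Rightarrow> 'a::euclidean_space) \<Rightarrow> real) \<Rightarrow> bool" where
  "L2_C11 P V \<longleftrightarrow>
     (\<exists>grad. (\<forall>X\<in>L2_space P. has_L2_gradient P V (grad X) X) \<and>
        (\<exists>L\<ge>0. \<forall>X\<in>L2_space P. \<forall>Y\<in>L2_space P.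
           L2_norm P (\<lambda>\<omega>. grad X \<omega> - grad Y \<omega>) \<le> L * L2_norm P (\<lambda>\<omega>. X \<omega> - Y \<omega>)))"

text \<open>
  For Lipschitz \<open>V\<close> the supremum is over a set bounded above and the infimum over a set bounded
  below, so that the conditionally complete operations on the reals give the intended values.
\<close>

definition lasry_lions ::
    "'w measure \<Rightarrow> real \<Rightarrow> (('w \<Rightarrow> 'a::euclidean_space) \<Rightarrow> real) \<Rightarrow> ('w \<Rightarrow> 'a) \<Rightarrow> real" where
  "lasry_lions P \<epsilon> V X =
     (INF Z\<in>L2_space P. SUP Y\<in>L2_space P.
        V Y - 1 / (2 * \<epsilon>) * (L2_norm P (\<lambda>\<omega>. Z \<omega> - Y \<omega>))\<^sup>2
            + 1 / \<epsilon> * (L2_norm P (\<lambda>\<omega>. Z \<omega> - X \<omega>))\<^sup>2)"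


section \<open>The Wasserstein space\<close>

definition P2 :: "'a::euclidean_space measure set" where
  "P2 = {\<mu>. prob_space \<mu> \<and> sets \<mu> = sets borel \<and> integrable \<mu> (\<lambda>x. (norm x)\<^sup>2)}"

definition couplings ::
    "'a::euclidean_space measure \<Rightarrow> 'a measure \<Rightarrow> ('a \<times> 'a) measure set" where
  "couplings \<mu> \<nu> =
     {\<gamma>. prob_space \<gamma> \<and> sets \<gamma> = sets borel \<and> distr \<gamma> borel fst = \<mu> \<and> distr \<gamma> borel snd = \<nu>}"

definition W2 :: "'a::euclidean_space measure \<Rightarrow> 'a measure \<Rightarrow> real" where
  "W2 \<mu> \<nu> = sqrt (INF \<gamma>\<in>couplings \<mu> \<nu>. \<integral>p. (dist (fst p) (snd p))\<^sup>2 \<partial>\<gamma>)"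

text \<open>Functions on the Wasserstein space are total; their values outside \<open>P2\<close> are irrelevant.\<close>

definition P2_lip_bound :: "('a::euclidean_space measure \<Rightarrow> real) \<Rightarrow> real \<Rightarrow> bool" where
  "P2_lip_bound G L \<longleftrightarrow> 0 \<le> L \<and> (\<forall>\<mu>\<in>P2. \<forall>\<nu>\<in>P2. \<bar>G \<mu> - G \<nu>\<bar> \<le> L * W2 \<mu> \<nu>)"

definition P2_lipschitz :: "('a::euclidean_space measure \<Rightarrow> real) \<Rightarrow> bool" where
  "P2_lipschitz G \<longleftrightarrow> (\<exists>L. P2_lip_bound G L)"

text \<open>The best Lipschitz constant; meaningful only if \<open>P2_lipschitz G\<close>.\<close>

definition P2_Lip :: "('a::euclidean_space measure \<Rightarrow> real) \<Rightarrow> real" where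
  "P2_Lip G = Inf {L. P2_lip_bound G L}"

definition convex_along_plans :: "('a::euclidean_space measure \<Rightarrow> real) \<Rightarrow> bool" where
  "convex_along_plans G \<longleftrightarrow>
     (\<forall>\<mu>\<in>P2. \<forall>\<nu>\<in>P2. \<forall>\<gamma>\<in>couplings \<mu> \<nu>. \<forall>t\<in>{0..1}.
        G (distr \<gamma> borel (\<lambda>p. (1 - t) *\<^sub>R fst p + t *\<^sub>R snd p)) \<le> (1 - t) * G \<mu> + t * G \<nu>)"

definition lift ::
    "'w measure \<Rightarrow> ('a::euclidean_space measure \<Rightarrow> real) \<Rightarrow> ('w \<Rightarrow> 'a) \<Rightarrow> real" where
  "lift P G X = G (distr P borel X)"

definition P2_C11 :: "'w measure \<Rightarrow> ('a::euclidean_space measure \<Rightarrow> real) \<Rightarrow> bool" where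
  "P2_C11 P G \<longleftrightarrow> L2_C11 P (lift P G)"

definition P2_lasry_lions ::
    "'w measure \<Rightarrow> real \<Rightarrow> ('a::euclidean_space measure \<Rightarrow> real) \<Rightarrow> 'a measure \<Rightarrow> real" where
  "P2_lasry_lions P \<epsilon> G \<mu> =
     (THE r. \<exists>X\<in>L2_space P. distr P borel X = \<mu> \<and> r = lasry_lions P \<epsilon> (lift P G) X)"

end

theory Submission
  imports Defs
begin

text \<open>
  Write \<open>V\<close> for the lift of \<open>G\<close>; it is Lipschitz on \<open>L\<^sup>2\<close> and invariant in law.  The regularization is
  \<open>INF Z. S Z + |Z - X|\<^sup>2 / \<epsilon>\<close> with \<open>S Z = SUP Y. V Y - |Z - Y|\<^sup>2 / (2 * \<epsilon>)\<close>.  As \<open>S + |.|\<^sup>2 / (2 * \<epsilon>)\<close> is a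
  supremum of affine functions, \<open>Z \<mapsto> S Z + |Z - X|\<^sup>2 / \<epsilon>\<close> is strongly convex; by completeness of \<open>L\<^sup>2\<close> it
  has a minimizer \<open>Z X\<close>, which is Lipschitz in \<open>X\<close>, and the gradient of the regularization is
  \<open>2 / \<epsilon> * (X - Z X)\<close>.  The Lipschitz bounds and convexity pass through both convolutions by translation and
  by convex combination of competitors.

  For invariance in law, let \<open>X\<close>, \<open>X'\<close> have the same law and let \<open>Y\<close> be a competitor for \<open>X\<close>.  After
  replacing \<open>X\<close>, \<open>X'\<close> by countably valued approximations, one transports the conditional laws of \<open>Y\<close> to
  obtain a competitor \<open>Y'\<close> for \<open>X'\<close> with the law of \<open>Y\<close> and almost the same distance.  Conditional laws can
  be realized because points are null: an injective Borel code turns the sample point into a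
  real random variable without atoms, whose distribution function is uniform.
\<close>

section \<open>The seminormed space of square-integrable maps\<close>

lemma borel_measurable_L2 [measurable_dest]: "X \<in> L2_space M \<Longrightarrow> X \<in> borel_measurable M"
  by (simp add: L2_space_def)

lemma integrable_L2_norm_sq: "X \<in> L2_space M \<Longrightarrow> integrable M (\<lambda>\<omega>. (norm (X \<omega>))\<^sup>2)"
  by (simp add: L2_space_def)

lemma L2_spaceI:
  "X \<in> borel_measurable M \<Longrightarrow> integrable M (\<lambda>\<omega>. (norm (X \<omega>))\<^sup>2) \<Longrightarrow> X \<in> L2_space M"
  by (simp add: L2_space_def)

lemma L2_space_add [intro, simp]:
  assumes "X \<in> L2_space M" "Y \<in> L2_space M"
  shows "(\<lambda>\<omega>. X \<omega> + Y \<omega>) \<in> L2_space M"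
proof (rule L2_spaceI)
  note [measurable] = assms[THEN borel_measurable_L2]
  show "(\<lambda>\<omega>. X \<omega> + Y \<omega>) \<in> borel_measurable M" by measurable
  have "integrable M (\<lambda>\<omega>. 2 * (norm (X \<omega>))\<^sup>2 + 2 * (norm (Y \<omega>))\<^sup>2)"
    using assms[THEN integrable_L2_norm_sq] by simp
  then show "integrable M (\<lambda>\<omega>. (norm (X \<omega> + Y \<omega>))\<^sup>2)"
  proof (rule Bochner_Integration.integrable_bound)
    show "(\<lambda>\<omega>. (norm (X \<omega> + Y \<omega>))\<^sup>2) \<in> borel_measurable M" by measurable
    have "(norm (x + y))\<^sup>2 \<le> 2 * (norm x)\<^sup>2 + 2 * (norm y)\<^sup>2" for x y :: 'b
    proof -
      have "(norm (x + y))\<^sup>2 + (norm (x - y))\<^sup>2 = 2 * (norm x)\<^sup>2 + 2 * (norm y)\<^sup>2"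
        by (simp add: power2_norm_eq_inner algebra_simps inner_commute)
      then show ?thesis using zero_le_power2[of "norm (x - y)"] by linarith
    qed
    then show "AE \<omega> in M. norm ((norm (X \<omega> + Y \<omega>))\<^sup>2) \<le> norm (2 * (norm (X \<omega>))\<^sup>2 + 2 * (norm (Y \<omega>))\<^sup>2)"
      by auto
  qed
qed

lemma L2_space_scaleR [intro, simp]:
  assumes "X \<in> L2_space M"
  shows "(\<lambda>\<omega>. c *\<^sub>R X \<omega>) \<in> L2_space M"
proof (rule L2_spaceI)
  note [measurable] = assms[THEN borel_measurable_L2]
  show "(\<lambda>\<omega>. c *\<^sub>R X \<omega>) \<in> borel_measurable M" by measurable
  show "integrable M (\<lambda>\<omega>. (norm (c *\<^sub>R X \<omega>))\<^sup>2)"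
    using integrable_L2_norm_sq[OF assms] by (simp add: power_mult_distrib)
qed

lemma L2_space_uminus [intro, simp]: "X \<in> L2_space M \<Longrightarrow> (\<lambda>\<omega>. - X \<omega>) \<in> L2_space M"
  using L2_space_scaleR[of X M "-1"] by simp

lemma L2_space_diff [intro, simp]:
  "X \<in> L2_space M \<Longrightarrow> Y \<in> L2_space M \<Longrightarrow> (\<lambda>\<omega>. X \<omega> - Y \<omega>) \<in> L2_space M"
  using L2_space_add[of X M "\<lambda>\<omega>. - Y \<omega>"] by auto

lemma (in finite_measure) L2_space_const [intro, simp]: "(\<lambda>\<omega>. c) \<in> L2_space M"
  by (rule L2_spaceI) auto

lemma (in finite_measure) L2_space_bounded_dist:
  assumes X: "X \<in> L2_space M" and [measurable]: "Y \<in> borel_measurable M"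
    and le: "\<And>\<omega>. norm (X \<omega> - Y \<omega>) \<le> c"
  shows "Y \<in> L2_space M"
proof -
  note [measurable] = X[THEN borel_measurable_L2]
  have "(\<lambda>\<omega>. X \<omega> - Y \<omega>) \<in> L2_space M"
  proof (rule L2_spaceI)
    show "integrable M (\<lambda>\<omega>. (norm (X \<omega> - Y \<omega>))\<^sup>2)"
      by (rule integrable_const_bound[where B="c\<^sup>2"]) (auto intro!: AE_I2 power_mono le)
  qed measurable
  from L2_space_diff[OF X this] show ?thesis by simp
qed

section \<open>Inner product, Cauchy-Schwarz and the triangle inequality\<close>

lemma integrable_L2_inner [intro, simp]:
  assumes "X \<in> L2_space M" "Y \<in> L2_space M"
  shows "integrable M (\<lambda>\<omega>. X \<omega> \<bullet> Y \<omega>)"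
proof -
  have "(\<lambda>\<omega>. X \<omega> \<bullet> Y \<omega>) = (\<lambda>\<omega>. ((norm (X \<omega> + Y \<omega>))\<^sup>2 - (norm (X \<omega>))\<^sup>2 - (norm (Y \<omega>))\<^sup>2) / 2)"
    by (auto simp: power2_norm_eq_inner algebra_simps inner_commute)
  moreover have "integrable M \<dots>"
    using assms by (intro integrable_divide_zero Bochner_Integration.integrable_diff integrable_L2_norm_sq) auto
  ultimately show ?thesis by simp
qed

lemma L2_norm_nonneg [simp]: "0 \<le> L2_norm M X"
  by (simp add: L2_norm_def)

lemma L2_norm_sq: "(L2_norm M X)\<^sup>2 = (\<integral>\<omega>. X \<omega> \<bullet> X \<omega> \<partial>M)"
  by (simp add: L2_norm_def power2_norm_eq_inner)

lemma L2_norm_zero [simp]: "L2_norm M (\<lambda>\<omega>. 0) = 0"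
  by (simp add: L2_norm_def)

lemma L2_norm_minus_commute: "L2_norm M (\<lambda>\<omega>. X \<omega> - Y \<omega>) = L2_norm M (\<lambda>\<omega>. Y \<omega> - X \<omega>)"
  by (simp add: L2_norm_def norm_minus_commute)

lemma L2_norm_scaleR: "L2_norm M (\<lambda>\<omega>. c *\<^sub>R X \<omega>) = \<bar>c\<bar> * L2_norm M X"
  by (simp add: L2_norm_def power_mult_distrib real_sqrt_mult)

lemma L2_inner_add_sq:
  assumes "X \<in> L2_space M" "Y \<in> L2_space M"
  shows "(L2_norm M (\<lambda>\<omega>. X \<omega> + Y \<omega>))\<^sup>2 = (L2_norm M X)\<^sup>2 + 2 * L2_inner M X Y + (L2_norm M Y)\<^sup>2"
proof -
  have "(\<lambda>\<omega>. (X \<omega> + Y \<omega>) \<bullet> (X \<omega> + Y \<omega>)) = (\<lambda>\<omega>. X \<omega> \<bullet> X \<omega> + 2 * (X \<omega> \<bullet> Y \<omega>) + Y \<omega> \<bullet> Y \<omega>)"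
    by (auto simp: algebra_simps inner_commute)
  then show ?thesis
    unfolding L2_norm_sq L2_inner_def using assms by simp
qed

lemma L2_inner_scaleR_right: "L2_inner M X (\<lambda>\<omega>. c *\<^sub>R Y \<omega>) = c * L2_inner M X Y"
  by (simp add: L2_inner_def)

lemma L2_inner_scaleR_left: "L2_inner M (\<lambda>\<omega>. c *\<^sub>R X \<omega>) Y = c * L2_inner M X Y"
  by (simp add: L2_inner_def)

lemma L2_inner_diff_left:
  assumes "X \<in> L2_space M" "Y \<in> L2_space M" "Z \<in> L2_space M"
  shows "L2_inner M (\<lambda>\<omega>. X \<omega> - Y \<omega>) Z = L2_inner M X Z - L2_inner M Y Z"
  using assms by (simp add: L2_inner_def inner_diff_left)

text \<open>Discriminant argument for the nonnegative quadratic \<open>|X + t Y|^2\<close> in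
  \<open>t\<close>. Since \<open>L2_norm\<close> is only a seminorm, \<open>L2_norm M Y = 0\<close>
  does not make \<open>Y\<close> zero, and this case needs its own argument.\<close>

lemma L2_Cauchy_Schwarz:
  assumes X: "X \<in> L2_space M" and Y: "Y \<in> L2_space M"
  shows "\<bar>L2_inner M X Y\<bar> \<le> L2_norm M X * L2_norm M Y"
proof -
  have pos: "0 \<le> (L2_norm M X)\<^sup>2 + 2 * t * L2_inner M X Y + t\<^sup>2 * (L2_norm M Y)\<^sup>2" for t
  proof -
    have "0 \<le> (L2_norm M (\<lambda>\<omega>. X \<omega> + t *\<^sub>R Y \<omega>))\<^sup>2" by simp
    also have "\<dots> = (L2_norm M X)\<^sup>2 + 2 * t * L2_inner M X Y + t\<^sup>2 * (L2_norm M Y)\<^sup>2"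
      using assms by (subst L2_inner_add_sq) (auto simp: L2_inner_scaleR_right L2_norm_scaleR power_mult_distrib)
    finally show ?thesis .
  qed
  have "(L2_inner M X Y)\<^sup>2 \<le> (L2_norm M X)\<^sup>2 * (L2_norm M Y)\<^sup>2"
  proof (cases "L2_norm M Y = 0")
    case True
    have "L2_inner M X Y = 0"
    proof (rule ccontr)
      assume "L2_inner M X Y \<noteq> 0"
      \<comment> \<open>The quadratic has become linear in \<open>t\<close>; at this
        \<open>t\<close> it takes the value -1.\<close>
      then show False
        using pos[of "- ((L2_norm M X)\<^sup>2 + 1) / (2 * L2_inner M X Y)"] True by (simp add: field_simps)
    qed
    then show ?thesis by simp
  next
    case False
    then have "0 < (L2_norm M Y)\<^sup>2" by simp
    \<comment> \<open>Value of the quadratic at its minimizer \<open>t = - b / y\<close>.\<close>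
    moreover have "x + 2 * (- b / y) * b + (- b / y)\<^sup>2 * y = x - b\<^sup>2 / y" if "0 < y" for x y b :: real
      using that by (simp add: field_simps power2_eq_square)
    ultimately have "0 \<le> (L2_norm M X)\<^sup>2 - (L2_inner M X Y)\<^sup>2 / (L2_norm M Y)\<^sup>2"
      using pos[of "- L2_inner M X Y / (L2_norm M Y)\<^sup>2"] by metis
    then show ?thesis
      using \<open>0 < (L2_norm M Y)\<^sup>2\<close> by (simp add: pos_divide_le_eq)
  qed
  then have "\<bar>L2_inner M X Y\<bar>\<^sup>2 \<le> (L2_norm M X * L2_norm M Y)\<^sup>2"
    by (simp add: power_mult_distrib)
  then show ?thesis
    by (rule power2_le_imp_le) simp
qed

lemma L2_norm_triangle:
  assumes X: "X \<in> L2_space M" and Y: "Y \<in> L2_space M"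
  shows "L2_norm M (\<lambda>\<omega>. X \<omega> + Y \<omega>) \<le> L2_norm M X + L2_norm M Y"
proof (rule power2_le_imp_le)
  show "(L2_norm M (\<lambda>\<omega>. X \<omega> + Y \<omega>))\<^sup>2 \<le> (L2_norm M X + L2_norm M Y)\<^sup>2"
    using L2_Cauchy_Schwarz[OF assms] unfolding L2_inner_add_sq[OF assms] power2_sum by linarith
qed simp

lemma L2_norm_triangle_diff:
  assumes "X \<in> L2_space M" "Y \<in> L2_space M" "Z \<in> L2_space M"
  shows "L2_norm M (\<lambda>\<omega>. X \<omega> - Z \<omega>) \<le> L2_norm M (\<lambda>\<omega>. X \<omega> - Y \<omega>) + L2_norm M (\<lambda>\<omega>. Y \<omega> - Z \<omega>)"
  using L2_norm_triangle[of "\<lambda>\<omega>. X \<omega> - Y \<omega>" M "\<lambda>\<omega>. Y \<omega> - Z \<omega>"] assms by simp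

lemma (in prob_space) L2_norm_le_bound:
  assumes [measurable]: "X \<in> borel_measurable M" and le: "\<And>\<omega>. norm (X \<omega>) \<le> c"
  shows "L2_norm M X \<le> c"
proof -
  have c: "0 \<le> c" using order_trans[OF norm_ge_zero le] .
  have "(\<integral>\<omega>. (norm (X \<omega>))\<^sup>2 \<partial>M) \<le> (\<integral>\<omega>. c\<^sup>2 \<partial>M)"
    by (intro integral_mono integrable_const_bound[where B="c\<^sup>2"]) (auto intro!: AE_I2 power_mono le)
  then show ?thesis
    unfolding L2_norm_def using c by (simp add: prob_space real_le_lsqrt)
qed

lemma nn_integral_L2_norm_sq:
  assumes "X \<in> L2_space M"
  shows "(\<integral>\<^sup>+\<omega>. ennreal ((norm (X \<omega>))\<^sup>2) \<partial>M) = ennreal ((L2_norm M X)\<^sup>2)"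
  using integrable_L2_norm_sq[OF assms]
  by (subst nn_integral_eq_integral) (auto simp: L2_norm_def)

text \<open>Cauchy-Schwarz against the constant 1. It turns small \<open>L2_norm\<close> increments
  into summable integrals in the completeness proof.\<close>

lemma (in prob_space) integral_norm_le_L2_norm:
  assumes X: "X \<in> L2_space M"
  shows "integrable M (\<lambda>\<omega>. norm (X \<omega>))" "(\<integral>\<omega>. norm (X \<omega>) \<partial>M) \<le> L2_norm M X"
proof -
  note [measurable] = X[THEN borel_measurable_L2]
  have N: "(\<lambda>\<omega>. norm (X \<omega>)) \<in> L2_space M"
    using integrable_L2_norm_sq[OF X] by (intro L2_spaceI) auto
  show "integrable M (\<lambda>\<omega>. norm (X \<omega>))"
    using integrable_L2_inner[OF N L2_space_const[of 1]] by simp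
  have "L2_norm M (\<lambda>\<omega>. 1::real) = 1" by (simp add: L2_norm_def prob_space)
  then show "(\<integral>\<omega>. norm (X \<omega>) \<partial>M) \<le> L2_norm M X"
    using L2_Cauchy_Schwarz[OF N L2_space_const[of 1]] by (simp add: L2_inner_def L2_norm_def)
qed

section \<open>Lower semicontinuity of the norm and completeness\<close>

text \<open>Fatou's lemma for the squared norms. Membership of \<open>Y\<close> is a conclusion,
  because completeness starts from a mere almost everywhere limit.\<close>

lemma L2_norm_Fatou:
  assumes X: "\<And>n. X n \<in> L2_space M" and [measurable]: "Y \<in> borel_measurable M"
    and lim: "AE \<omega> in M. (\<lambda>n. X n \<omega>) \<longlonglongrightarrow> Y \<omega>"
    and le: "eventually (\<lambda>n. L2_norm M (X n) \<le> c) sequentially"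
  shows "Y \<in> L2_space M" "L2_norm M Y \<le> c"
proof -
  note [measurable] = X[THEN borel_measurable_L2]
  obtain n where "L2_norm M (X n) \<le> c" using eventually_happens[OF le] by auto
  then have c: "0 \<le> c" using L2_norm_nonneg order_trans by blast
  have "(\<integral>\<^sup>+\<omega>. ennreal ((norm (Y \<omega>))\<^sup>2) \<partial>M) = (\<integral>\<^sup>+\<omega>. liminf (\<lambda>n. ennreal ((norm (X n \<omega>))\<^sup>2)) \<partial>M)"
  proof (rule nn_integral_cong_AE)
    show "AE \<omega> in M. ennreal ((norm (Y \<omega>))\<^sup>2) = liminf (\<lambda>n. ennreal ((norm (X n \<omega>))\<^sup>2))"
      using lim
    proof eventually_elim
      case (elim \<omega>)
      then have "(\<lambda>n. ennreal ((norm (X n \<omega>))\<^sup>2)) \<longlonglongrightarrow> ennreal ((norm (Y \<omega>))\<^sup>2)"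
        by (intro tendsto_intros) auto
      then show ?case by (rule lim_imp_Liminf[symmetric, OF sequentially_bot])
    qed
  qed
  also have "\<dots> \<le> liminf (\<lambda>n. \<integral>\<^sup>+\<omega>. ennreal ((norm (X n \<omega>))\<^sup>2) \<partial>M)"
    by (rule nn_integral_liminf) measurable
  also have "\<dots> = liminf (\<lambda>n. ennreal ((L2_norm M (X n))\<^sup>2))"
    by (simp add: nn_integral_L2_norm_sq X)
  also have "\<dots> \<le> ennreal (c\<^sup>2)"
  proof (rule order_trans[OF Liminf_le_Limsup Limsup_bounded])
    show "\<forall>\<^sub>F n in sequentially. ennreal ((L2_norm M (X n))\<^sup>2) \<le> ennreal (c\<^sup>2)"
      using le by eventually_elim (auto intro!: ennreal_leI power_mono)
  qed simp
  finally have *: "(\<integral>\<^sup>+\<omega>. ennreal ((norm (Y \<omega>))\<^sup>2) \<partial>M) \<le> ennreal (c\<^sup>2)" .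
  then have "integrable M (\<lambda>\<omega>. (norm (Y \<omega>))\<^sup>2)"
    by (intro integrableI_bounded) (auto simp: le_less_trans)
  then show Y: "Y \<in> L2_space M" by (intro L2_spaceI) auto
  have "(L2_norm M Y)\<^sup>2 \<le> c\<^sup>2"
    using * unfolding nn_integral_L2_norm_sq[OF Y] by (simp add: ennreal_le_iff)
  then show "L2_norm M Y \<le> c"
    using c by (rule power2_le_imp_le)
qed

text \<open>Riesz-Fischer: a subsequence with geometrically small increments converges almost
  everywhere, and \<open>L2_norm_Fatou\<close> upgrades this to convergence of the whole sequence in
  norm.\<close>

lemma (in prob_space) L2_complete:
  assumes X: "\<And>n. X n \<in> L2_space M"
    and Cauchy: "\<And>e. 0 < e \<Longrightarrow> \<exists>N. \<forall>m\<ge>N. \<forall>n\<ge>N. L2_norm M (\<lambda>\<omega>. X m \<omega> - X n \<omega>) < e"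
  obtains Y where "Y \<in> L2_space M" "(\<lambda>n. L2_norm M (\<lambda>\<omega>. X n \<omega> - Y \<omega>)) \<longlonglongrightarrow> 0"
proof -
  note [measurable] = X[THEN borel_measurable_L2]
  have "\<forall>k. \<exists>N. \<forall>m\<ge>N. \<forall>n\<ge>N. L2_norm M (\<lambda>\<omega>. X m \<omega> - X n \<omega>) < (1/2)^k"
    using Cauchy by simp
  then obtain N where N: "\<And>k m n. m \<ge> N k \<Longrightarrow> n \<ge> N k \<Longrightarrow> L2_norm M (\<lambda>\<omega>. X m \<omega> - X n \<omega>) < (1/2)^k"
    by metis
  \<comment> \<open>Summing the thresholds makes \<open>r\<close> monotone and at least
    \<open>N k\<close>; the extra \<open>k\<close> makes it unbounded, so that \<open>W\<close>
    eventually passes every threshold.\<close>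
  define r where "r k = (\<Sum>i\<le>k. N i) + k" for k
  have r_ge: "N k \<le> r k" for k
    unfolding r_def using member_le_sum[of k "{..k}" N] by simp
  have r_Suc: "r k \<le> r (Suc k)" for k
    by (simp add: r_def)
  have r_ge': "k \<le> r k" for k
    by (simp add: r_def)
  define W where "W k = X (r k)" for k
  have W: "W k \<in> L2_space M" for k by (simp add: W_def X)
  note [measurable] = W[THEN borel_measurable_L2]
  have step: "(\<integral>\<^sup>+\<omega>. ennreal (norm (W (Suc k) \<omega> - W k \<omega>)) \<partial>M) \<le> ennreal ((1/2)^k)" for k
  proof -
    have D: "(\<lambda>\<omega>. W (Suc k) \<omega> - W k \<omega>) \<in> L2_space M" using W by simp
    have "(\<integral>\<^sup>+\<omega>. ennreal (norm (W (Suc k) \<omega> - W k \<omega>)) \<partial>M) = ennreal (\<integral>\<omega>. norm (W (Suc k) \<omega> - W k \<omega>) \<partial>M)"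
      by (rule nn_integral_eq_integral) (use integral_norm_le_L2_norm(1)[OF D] in auto)
    also have "\<dots> \<le> ennreal ((1/2)^k)"
      using integral_norm_le_L2_norm(2)[OF D] N[of k "r (Suc k)" "r k"] r_ge[of k] r_Suc[of k]
      by (intro ennreal_leI) (simp add: W_def)
    finally show ?thesis .
  qed
  have "(\<integral>\<^sup>+\<omega>. (\<Sum>k. ennreal (norm (W (Suc k) \<omega> - W k \<omega>))) \<partial>M)
      = (\<Sum>k. \<integral>\<^sup>+\<omega>. ennreal (norm (W (Suc k) \<omega> - W k \<omega>)) \<partial>M)"
    by (rule nn_integral_suminf) measurable
  also have "\<dots> \<le> (\<Sum>k. ennreal ((1/2)^k))"
    by (intro suminf_le step) auto
  also have "\<dots> = ennreal (\<Sum>k. (1/2)^k)"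
    by (rule suminf_ennreal2) (auto simp: summable_geometric)
  also have "\<dots> < \<infinity>" by simp
  finally have "AE \<omega> in M. (\<Sum>k. ennreal (norm (W (Suc k) \<omega> - W k \<omega>))) \<noteq> \<infinity>"
    by (intro nn_integral_PInf_AE) auto
  then have conv: "AE \<omega> in M. convergent (\<lambda>k. W k \<omega>)"
  proof eventually_elim
    case (elim \<omega>)
    then have "summable (\<lambda>k. norm (W (Suc k) \<omega> - W k \<omega>))"
      by (intro summable_suminf_not_top) auto
    then have "summable (\<lambda>k. W (Suc k) \<omega> - W k \<omega>)"
      by (rule summable_norm_cancel)
    then have "convergent (\<lambda>n. W 0 \<omega> + (\<Sum>k<n. W (Suc k) \<omega> - W k \<omega>))"
      by (simp add: summable_iff_convergent convergent_add_const_iff)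
    moreover have "(\<lambda>n. W 0 \<omega> + (\<Sum>k<n. W (Suc k) \<omega> - W k \<omega>)) = (\<lambda>k. W k \<omega>)"
      using sum_lessThan_telescope[of "\<lambda>k. W k \<omega>"] by simp
    ultimately show ?case by simp
  qed
  define Y where "Y \<omega> = lim (\<lambda>k. W k \<omega>)" for \<omega>
  have [measurable]: "Y \<in> borel_measurable M"
    unfolding Y_def by (rule borel_measurable_lim_metric) measurable
  have lim: "AE \<omega> in M. (\<lambda>k. W k \<omega>) \<longlonglongrightarrow> Y \<omega>"
    using conv by eventually_elim (simp add: Y_def convergent_LIMSEQ_iff)
  \<comment> \<open>The index \<open>n\<close> stays fixed while the other index tends to infinity
    along the subsequence.\<close>
  have *: "(\<lambda>\<omega>. X n \<omega> - Y \<omega>) \<in> L2_space M \<and> L2_norm M (\<lambda>\<omega>. X n \<omega> - Y \<omega>) \<le> (1/2)^k" if "n \<ge> N k" for n k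
  proof -
    have "AE \<omega> in M. (\<lambda>j. X n \<omega> - W j \<omega>) \<longlonglongrightarrow> X n \<omega> - Y \<omega>"
      using lim by eventually_elim (intro tendsto_intros)
    moreover have "\<forall>\<^sub>F j in sequentially. L2_norm M (\<lambda>\<omega>. X n \<omega> - W j \<omega>) \<le> (1/2)^k"
      using eventually_ge_at_top[of "N k"]
    proof eventually_elim
      case (elim j)
      then have "N k \<le> r j" using r_ge'[of j] by simp
      then show ?case unfolding W_def using N[OF that, of "r j"] by simp
    qed
    ultimately show ?thesis
      using L2_norm_Fatou[of "\<lambda>j \<omega>. X n \<omega> - W j \<omega>" M "\<lambda>\<omega>. X n \<omega> - Y \<omega>" "(1/2)^k"] X W by simp
  qed
  show ?thesis
  proof
    have "(\<lambda>\<omega>. X (N 0) \<omega> - (X (N 0) \<omega> - Y \<omega>)) \<in> L2_space M"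
      by (rule L2_space_diff[OF X]) (use * in blast)
    then show "Y \<in> L2_space M" by simp
    show "(\<lambda>n. L2_norm M (\<lambda>\<omega>. X n \<omega> - Y \<omega>)) \<longlonglongrightarrow> 0"
    proof (rule LIMSEQ_I)
      fix e :: real assume "0 < e"
      then obtain k where k: "(1/2)^k < e" using real_arch_pow_inv[of e "1/2"] by auto
      have "L2_norm M (\<lambda>\<omega>. X n \<omega> - Y \<omega>) < e" if "N k \<le> n" for n
        using conjunct2[OF *[OF that]] k by linarith
      then show "\<exists>n0. \<forall>n\<ge>n0. norm (L2_norm M (\<lambda>\<omega>. X n \<omega> - Y \<omega>) - 0) < e"
        by auto
    qed
  qed
qed

section \<open>Quadratic identities for convex combinations and shifts\<close>

abbreviation L2_dist :: "'w measure \<Rightarrow> ('w \<Rightarrow> 'a::euclidean_space) \<Rightarrow> ('w \<Rightarrow> 'a) \<Rightarrow> real" where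
  "L2_dist M X Y \<equiv> L2_norm M (\<lambda>\<omega>. X \<omega> - Y \<omega>)"

lemma L2_space_convex [intro, simp]:
  "X \<in> L2_space M \<Longrightarrow> Y \<in> L2_space M \<Longrightarrow> (\<lambda>\<omega>. (1 - t) *\<^sub>R X \<omega> + t *\<^sub>R Y \<omega>) \<in> L2_space M"
  by (intro L2_space_add L2_space_scaleR)

text \<open>The exact defect term is kept: it is the source of strong convexity, and for
  \<open>t\<close> in the unit interval it may be dropped to give convexity.\<close>

lemma L2_norm_convex_sq:
  assumes "X \<in> L2_space M" "Y \<in> L2_space M"
  shows "(L2_norm M (\<lambda>\<omega>. (1 - t) *\<^sub>R X \<omega> + t *\<^sub>R Y \<omega>))\<^sup>2
       = (1 - t) * (L2_norm M X)\<^sup>2 + t * (L2_norm M Y)\<^sup>2 - t * (1 - t) * (L2_dist M X Y)\<^sup>2"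
proof -
  have "(\<lambda>\<omega>. ((1 - t) *\<^sub>R X \<omega> + t *\<^sub>R Y \<omega>) \<bullet> ((1 - t) *\<^sub>R X \<omega> + t *\<^sub>R Y \<omega>))
    = (\<lambda>\<omega>. (1 - t) * (X \<omega> \<bullet> X \<omega>) + t * (Y \<omega> \<bullet> Y \<omega>) - t * (1 - t) * ((X \<omega> - Y \<omega>) \<bullet> (X \<omega> - Y \<omega>)))"
    by (rule ext) (simp add: inner_commute algebra_simps)
  then show ?thesis
    unfolding L2_norm_sq using assms by simp
qed

lemma L2_dist_convex_sq:
  assumes "X \<in> L2_space M" "Y \<in> L2_space M" "Z \<in> L2_space M"
  shows "(L2_dist M (\<lambda>\<omega>. (1 - t) *\<^sub>R X \<omega> + t *\<^sub>R Y \<omega>) Z)\<^sup>2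
       = (1 - t) * (L2_dist M X Z)\<^sup>2 + t * (L2_dist M Y Z)\<^sup>2 - t * (1 - t) * (L2_dist M X Y)\<^sup>2"
  using L2_norm_convex_sq[of "\<lambda>\<omega>. X \<omega> - Z \<omega>" M "\<lambda>\<omega>. Y \<omega> - Z \<omega>" t] assms
  by (simp add: algebra_simps)

text \<open>The linear term in \<open>Y - X\<close> becomes the gradient of the regularization; its
  variation with \<open>Z\<close> governs the dependence of minimizers on the base point.\<close>

lemma L2_dist_sq_shift:
  assumes "X \<in> L2_space M" "Y \<in> L2_space M" "Z \<in> L2_space M"
  shows "(L2_dist M Z Y)\<^sup>2
       = (L2_dist M Z X)\<^sup>2 + 2 * L2_inner M (\<lambda>\<omega>. X \<omega> - Z \<omega>) (\<lambda>\<omega>. Y \<omega> - X \<omega>) + (L2_dist M Y X)\<^sup>2"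
  using L2_inner_add_sq[of "\<lambda>\<omega>. X \<omega> - Z \<omega>" M "\<lambda>\<omega>. Y \<omega> - X \<omega>"] assms
  by (simp add: L2_norm_minus_commute[of M Z])

lemma L2_space_zero: "(\<lambda>\<omega>. 0) \<in> L2_space M"
  by (simp add: L2_space_def)

lemma L2_space_nonempty [simp]: "L2_space M \<noteq> {}"
  using L2_space_zero by blast

section \<open>Sup-convolution and Lasry--Lions regularization\<close>

text \<open>The inner supremum of \<open>lasry_lions\<close>, with the term in \<open>X\<close>,
  constant in \<open>Y\<close>, split off.\<close>

definition sup_conv ::
    "'w measure \<Rightarrow> real \<Rightarrow> (('w \<Rightarrow> 'a::euclidean_space) \<Rightarrow> real) \<Rightarrow> ('w \<Rightarrow> 'a) \<Rightarrow> real" where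
  "sup_conv P \<epsilon> V Z = (SUP Y\<in>L2_space P. V Y - 1 / (2 * \<epsilon>) * (L2_dist P Z Y)\<^sup>2)"

text \<open>Differentiability, the error bounds and convexity rest on the Lipschitz bound alone;
  laws enter in a later locale. \<open>L\<close> may be any Lipschitz constant.\<close>

locale lipschitz_functional = prob_space P for P :: "'w measure" +
  fixes V :: "('w \<Rightarrow> 'a::euclidean_space) \<Rightarrow> real" and L \<epsilon> :: real
  assumes L_nonneg: "0 \<le> L" and eps_pos: "0 < \<epsilon>"
    and Lip: "X \<in> L2_space P \<Longrightarrow> Y \<in> L2_space P \<Longrightarrow> \<bar>V X - V Y\<bar> \<le> L * L2_dist P X Y"
begin

abbreviation \<H> :: "('w \<Rightarrow> 'a) set" where "\<H> \<equiv> L2_space P"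

section \<open>Bounds, Lipschitz continuity and semiconvexity of the sup-convolution\<close>

text \<open>With \<open>d\<close> the distance of \<open>Z\<close> and \<open>Y\<close>, completing
  the square bounds the gain \<open>L * d\<close> minus the penalty; equality at
  \<open>d = \<epsilon> * L\<close> explains the constant.\<close>

lemma penalized_le:
  assumes "Y \<in> \<H>" "Z \<in> \<H>"
  shows "V Y - 1 / (2 * \<epsilon>) * (L2_dist P Z Y)\<^sup>2 \<le> V Z + L\<^sup>2 / 2 * \<epsilon>"
proof -
  have "L * d - 1 / (2 * \<epsilon>) * d\<^sup>2 \<le> L\<^sup>2 / 2 * \<epsilon>" for d
  proof -
    have "L\<^sup>2 / 2 * \<epsilon> - (L * d - 1 / (2 * \<epsilon>) * d\<^sup>2) = (d - \<epsilon> * L)\<^sup>2 / (2 * \<epsilon>)"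
      using eps_pos by (simp add: field_simps power2_eq_square)
    moreover have "0 \<le> (d - \<epsilon> * L)\<^sup>2 / (2 * \<epsilon>)" using eps_pos by simp
    ultimately show ?thesis by linarith
  qed
  from this[of "L2_dist P Z Y"] show ?thesis
    using Lip[OF assms] by (simp add: L2_norm_minus_commute[of P Y])
qed

lemma sup_conv_bdd:
  "Z \<in> \<H> \<Longrightarrow> bdd_above ((\<lambda>Y. V Y - 1 / (2 * \<epsilon>) * (L2_dist P Z Y)\<^sup>2) ` \<H>)"
  using penalized_le by (intro bdd_aboveI2) blast

lemma sup_conv_upper:
  assumes "Y \<in> \<H>" "Z \<in> \<H>"
  shows "V Y - 1 / (2 * \<epsilon>) * (L2_dist P Z Y)\<^sup>2 \<le> sup_conv P \<epsilon> V Z"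
  unfolding sup_conv_def by (rule cSUP_upper[OF assms(1) sup_conv_bdd[OF assms(2)]])

lemma sup_conv_least:
  assumes "\<And>Y. Y \<in> \<H> \<Longrightarrow> V Y - 1 / (2 * \<epsilon>) * (L2_dist P Z Y)\<^sup>2 \<le> c"
  shows "sup_conv P \<epsilon> V Z \<le> c"
  unfolding sup_conv_def using assms by (intro cSUP_least) auto

lemma sup_conv_le: "Z \<in> \<H> \<Longrightarrow> sup_conv P \<epsilon> V Z \<le> V Z + L\<^sup>2 / 2 * \<epsilon>"
  using penalized_le by (intro sup_conv_least) auto

text \<open>Translating a competitor \<open>Y\<close> by \<open>W - Z\<close> leaves the penalty
  unchanged and alters \<open>V\<close> by at most \<open>L\<close> times the distance of
  \<open>Z\<close> and \<open>W\<close>.\<close>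

lemma sup_conv_Lip_le:
  assumes Z: "Z \<in> \<H>" and W: "W \<in> \<H>"
  shows "sup_conv P \<epsilon> V Z \<le> sup_conv P \<epsilon> V W + L * L2_dist P Z W"
proof (rule sup_conv_least)
  fix Y assume Y: "Y \<in> \<H>"
  let ?Y = "\<lambda>\<omega>. W \<omega> - (Z \<omega> - Y \<omega>)"
  have "V Y \<le> V ?Y + L * L2_dist P Z W"
    using Lip[of Y ?Y] Y Z W by simp
  moreover have "V ?Y - 1 / (2 * \<epsilon>) * (L2_dist P Z Y)\<^sup>2 \<le> sup_conv P \<epsilon> V W"
    using sup_conv_upper[of ?Y W] Y Z W by simp
  ultimately show "V Y - 1 / (2 * \<epsilon>) * (L2_dist P Z Y)\<^sup>2 \<le> sup_conv P \<epsilon> V W + L * L2_dist P Z W"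
    by linarith
qed

text \<open>The left sides are left unsimplified to match \<open>L2_dist_convex_sq\<close> at
  \<open>t = 1/2\<close>. The defect of the outer quadratic is twice that of the inner one; the
  surplus is the strong convexity used below.\<close>

lemma half_sq_identity:
  "1 / (2 * \<epsilon>) * ((1 - 1/2) * a\<^sup>2 + 1/2 * b\<^sup>2 - 1/2 * (1 - 1/2) * c\<^sup>2)
   = 1 / (2 * \<epsilon>) * a\<^sup>2 / 2 + 1 / (2 * \<epsilon>) * b\<^sup>2 / 2 - 1 / (8 * \<epsilon>) * c\<^sup>2"
  "1 / \<epsilon> * ((1 - 1/2) * a\<^sup>2 + 1/2 * b\<^sup>2 - 1/2 * (1 - 1/2) * c\<^sup>2)
   = 1 / \<epsilon> * a\<^sup>2 / 2 + 1 / \<epsilon> * b\<^sup>2 / 2 - 2 * (1 / (8 * \<epsilon>) * c\<^sup>2)"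
  using eps_pos by (simp_all add: field_simps)

text \<open>For fixed \<open>Y\<close> the midpoint defect of the quadratic does not depend on
  \<open>Y\<close>, so the estimate survives the supremum.\<close>

lemma sup_conv_midpoint:
  assumes Z: "Z \<in> \<H>" and W: "W \<in> \<H>"
  shows "sup_conv P \<epsilon> V (\<lambda>\<omega>. (1 - 1/2) *\<^sub>R Z \<omega> + (1/2) *\<^sub>R W \<omega>)
    \<le> sup_conv P \<epsilon> V Z / 2 + sup_conv P \<epsilon> V W / 2 + 1 / (8 * \<epsilon>) * (L2_dist P Z W)\<^sup>2"
proof (rule sup_conv_least)
  fix Y assume Y: "Y \<in> \<H>"
  show "V Y - 1 / (2 * \<epsilon>) * (L2_dist P (\<lambda>\<omega>. (1 - 1/2) *\<^sub>R Z \<omega> + (1/2) *\<^sub>R W \<omega>) Y)\<^sup>2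
     \<le> sup_conv P \<epsilon> V Z / 2 + sup_conv P \<epsilon> V W / 2 + 1 / (8 * \<epsilon>) * (L2_dist P Z W)\<^sup>2"
    using sup_conv_upper[OF Y Z] sup_conv_upper[OF Y W]
      half_sq_identity[of "L2_dist P Z Y" "L2_dist P W Y" "L2_dist P Z W"]
    unfolding L2_dist_convex_sq[OF Z W Y] by argo
qed

section \<open>The outer minimization problem\<close>

text \<open>The whole objective of the outer infimum at base point \<open>X\<close>.\<close>

definition penalty :: "('w \<Rightarrow> 'a) \<Rightarrow> ('w \<Rightarrow> 'a) \<Rightarrow> real" where
  "penalty X Z = sup_conv P \<epsilon> V Z + 1 / \<epsilon> * (L2_dist P Z X)\<^sup>2"

lemma lasry_lions_eq_INF: "lasry_lions P \<epsilon> V X = (INF Z\<in>\<H>. penalty X Z)"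
  unfolding lasry_lions_def
proof (rule INF_cong[OF refl])
  fix Z assume Z: "Z \<in> \<H>"
  let ?f = "\<lambda>Y. V Y - 1 / (2 * \<epsilon>) * (L2_dist P Z Y)\<^sup>2"
  let ?c = "1 / \<epsilon> * (L2_dist P Z X)\<^sup>2"
  show "(SUP Y\<in>\<H>. ?f Y + ?c) = penalty X Z"
  proof (rule antisym)
    show "(SUP Y\<in>\<H>. ?f Y + ?c) \<le> penalty X Z"
      using sup_conv_upper[OF _ Z] unfolding penalty_def by (intro cSUP_least) auto
    have bdd: "bdd_above ((\<lambda>Y. ?f Y + ?c) ` \<H>)"
      using sup_conv_upper[OF _ Z] by (intro bdd_aboveI2[where M="sup_conv P \<epsilon> V Z + ?c"]) auto
    have "sup_conv P \<epsilon> V Z \<le> (SUP Y\<in>\<H>. ?f Y + ?c) - ?c"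
    proof (rule sup_conv_least)
      fix Y assume "Y \<in> \<H>"
      from cSUP_upper[OF this bdd] show "?f Y \<le> (SUP Y\<in>\<H>. ?f Y + ?c) - ?c" by linarith
    qed
    then show "penalty X Z \<le> (SUP Y\<in>\<H>. ?f Y + ?c)"
      unfolding penalty_def by linarith
  qed
qed

text \<open>Testing the inner supremum with \<open>Y = X\<close>.\<close>

lemma penalty_ge:
  assumes X: "X \<in> \<H>" and Z: "Z \<in> \<H>"
  shows "V X \<le> penalty X Z"
proof -
  have "V X - 1 / (2 * \<epsilon>) * (L2_dist P Z X)\<^sup>2 \<le> sup_conv P \<epsilon> V Z"
    by (rule sup_conv_upper[OF X Z])
  moreover have "1 / (2 * \<epsilon>) * (L2_dist P Z X)\<^sup>2 \<le> 1 / \<epsilon> * (L2_dist P Z X)\<^sup>2"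
    using eps_pos by (intro mult_right_mono) (auto simp: field_simps)
  ultimately show ?thesis unfolding penalty_def by linarith
qed

lemma lasry_lions_le:
  assumes "X \<in> \<H>" "Z \<in> \<H>"
  shows "lasry_lions P \<epsilon> V X \<le> penalty X Z"
  unfolding lasry_lions_eq_INF using penalty_ge[OF assms(1)] assms(2)
  by (intro cINF_lower bdd_belowI2) auto

lemma lasry_lions_ge: "X \<in> \<H> \<Longrightarrow> V X \<le> lasry_lions P \<epsilon> V X"
  unfolding lasry_lions_eq_INF using penalty_ge by (intro cINF_greatest) auto

text \<open>Testing the outer infimum with \<open>Z = X\<close>.\<close>

lemma lasry_lions_upper:
  assumes "X \<in> \<H>"
  shows "lasry_lions P \<epsilon> V X \<le> V X + L\<^sup>2 / 2 * \<epsilon>"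
  using lasry_lions_le[OF assms assms] sup_conv_le[OF assms] by (simp add: penalty_def)

text \<open>The outer quadratic gains twice what the sup-convolution loses at the midpoint. Bounding
  the midpoint value below by the infimum, one controls the distance of any two
  near-minimizers.\<close>

lemma penalty_midpoint:
  assumes X: "X \<in> \<H>" and Z: "Z \<in> \<H>" and W: "W \<in> \<H>"
  shows "lasry_lions P \<epsilon> V X + 1 / (8 * \<epsilon>) * (L2_dist P Z W)\<^sup>2 \<le> penalty X Z / 2 + penalty X W / 2"
proof -
  let ?M = "\<lambda>\<omega>. (1 - 1/2) *\<^sub>R Z \<omega> + (1/2) *\<^sub>R W \<omega>"
  have "lasry_lions P \<epsilon> V X \<le> penalty X ?M"
    using assms by (intro lasry_lions_le L2_space_convex)
  moreover have "penalty X ?M + 1 / (8 * \<epsilon>) * (L2_dist P Z W)\<^sup>2 \<le> penalty X Z / 2 + penalty X W / 2"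
    using sup_conv_midpoint[OF Z W]
    unfolding penalty_def L2_dist_convex_sq[OF Z W X] half_sq_identity(2) by argo
  ultimately show ?thesis by linarith
qed

text \<open>The quadratic is expanded at \<open>Z\<close>, its second-order term dropped by sign and
  its linear term bounded by Cauchy-Schwarz. This lets the objective pass to the limit of a
  minimizing sequence.\<close>

lemma penalty_Lip_le:
  assumes "X \<in> \<H>" "Z \<in> \<H>" "W \<in> \<H>"
  shows "penalty X Z \<le> penalty X W + (L + 2 / \<epsilon> * L2_dist P Z X) * L2_dist P Z W"
proof -
  have "(L2_dist P W X)\<^sup>2 \<ge> (L2_dist P Z X)\<^sup>2 - 2 * (L2_dist P Z X * L2_dist P Z W)"
  proof -
    have "(L2_dist P X W)\<^sup>2 \<ge> (L2_dist P X Z)\<^sup>2 + 2 * L2_inner P (\<lambda>\<omega>. Z \<omega> - X \<omega>) (\<lambda>\<omega>. W \<omega> - Z \<omega>)"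
      using assms by (simp add: L2_dist_sq_shift[of Z P W X])
    moreover have "\<bar>L2_inner P (\<lambda>\<omega>. Z \<omega> - X \<omega>) (\<lambda>\<omega>. W \<omega> - Z \<omega>)\<bar> \<le> L2_dist P Z X * L2_dist P W Z"
      using assms by (intro L2_Cauchy_Schwarz) auto
    ultimately show ?thesis
      by (simp add: L2_norm_minus_commute[of P X] L2_norm_minus_commute[of P W Z])
  qed
  then have "1 / \<epsilon> * ((L2_dist P Z X)\<^sup>2 - 2 * (L2_dist P Z X * L2_dist P Z W)) \<le> 1 / \<epsilon> * (L2_dist P W X)\<^sup>2"
    using eps_pos by (intro mult_left_mono) auto
  then show ?thesis
    using sup_conv_Lip_le[OF assms(2,3)] unfolding penalty_def by (simp add: algebra_simps)
qed

text \<open>Midpoint strong convexity of \<open>penalty X\<close> makes every minimizing sequence Cauchy.\<close>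

lemma minimizer_exists:
  assumes X: "X \<in> \<H>"
  shows "\<exists>Z\<in>\<H>. penalty X Z = lasry_lions P \<epsilon> V X"
proof -
  let ?m = "lasry_lions P \<epsilon> V X"
  have "\<exists>Z\<in>\<H>. penalty X Z < ?m + inverse (Suc n)" for n
  proof (rule ccontr)
    assume "\<not> (\<exists>Z\<in>\<H>. penalty X Z < ?m + inverse (Suc n))"
    then have "?m + inverse (Suc n) \<le> ?m"
      unfolding lasry_lions_eq_INF[of X] by (intro cINF_greatest) (auto simp: not_less)
    then show False by simp
  qed
  then obtain Z where Z: "\<And>n. Z n \<in> \<H>" and Zm: "\<And>n. penalty X (Z n) < ?m + inverse (Suc n)"
    by metis
  have dist: "(L2_dist P (Z i) (Z j))\<^sup>2 \<le> 8 * \<epsilon> * inverse (Suc n)" if "n \<le> i" "n \<le> j" for i j n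
  proof -
    have "inverse (real (Suc i)) \<le> inverse (Suc n)" "inverse (real (Suc j)) \<le> inverse (Suc n)"
      using that by (auto intro: le_imp_inverse_le)
    then have "1 / (8 * \<epsilon>) * (L2_dist P (Z i) (Z j))\<^sup>2 \<le> inverse (Suc n)"
      using penalty_midpoint[OF X Z Z, of i j] Zm[of i] Zm[of j] by linarith
    then show ?thesis
      using eps_pos by (simp add: field_simps)
  qed
  have "\<exists>N. \<forall>i\<ge>N. \<forall>j\<ge>N. L2_dist P (Z i) (Z j) < e" if "0 < e" for e
  proof -
    have "0 < e\<^sup>2 / (8 * \<epsilon>)" using that eps_pos by simp
    then obtain N where N: "inverse (real (Suc N)) < e\<^sup>2 / (8 * \<epsilon>)"
      using reals_Archimedean by blast
    show ?thesis
    proof (intro exI[of _ N] allI impI)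
      fix i j assume "N \<le> i" "N \<le> j"
      from dist[OF this] have "(L2_dist P (Z i) (Z j))\<^sup>2 \<le> 8 * \<epsilon> * inverse (Suc N)" .
      also have "\<dots> < e\<^sup>2" using N eps_pos by (simp add: field_simps)
      finally show "L2_dist P (Z i) (Z j) < e"
        by (rule power2_less_imp_less) (use that in simp)
    qed
  qed
  with Z obtain W where W: "W \<in> \<H>" and lim: "(\<lambda>n. L2_dist P (Z n) W) \<longlonglongrightarrow> 0"
    by (rule L2_complete)
  \<comment> \<open>The expansion is taken at the limit \<open>W\<close>, so the coefficient does
    not depend on \<open>n\<close>.\<close>
  have "(\<lambda>n. ?m + inverse (real (Suc n)) + (L + 2 / \<epsilon> * L2_dist P W X) * L2_dist P (Z n) W)
      \<longlonglongrightarrow> ?m + 0 + (L + 2 / \<epsilon> * L2_dist P W X) * 0"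
    by (intro tendsto_intros lim LIMSEQ_inverse_real_of_nat)
  moreover have "penalty X W \<le> ?m + inverse (real (Suc n)) + (L + 2 / \<epsilon> * L2_dist P W X) * L2_dist P (Z n) W" for n
    using penalty_Lip_le[OF X W Z, of n] Zm[of n] by (simp add: L2_norm_minus_commute[of P W "Z n"])
  ultimately have "penalty X W \<le> ?m"
    by (intro tendsto_lowerbound) auto
  then show ?thesis
    using lasry_lions_le[OF X W] W by force
qed

section \<open>Minimizer map, gradient and differentiability\<close>

text \<open>Minimizers are determined only up to null sets; \<open>SOME\<close> fixes a
  representative.\<close>

definition minimizer :: "('w \<Rightarrow> 'a) \<Rightarrow> 'w \<Rightarrow> 'a" where
  "minimizer X = (SOME Z. Z \<in> \<H> \<and> penalty X Z = lasry_lions P \<epsilon> V X)"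

lemma
  assumes "X \<in> \<H>"
  shows minimizer_L2: "minimizer X \<in> \<H>"
    and penalty_minimizer: "penalty X (minimizer X) = lasry_lions P \<epsilon> V X"
  using someI_ex[of "\<lambda>Z. Z \<in> \<H> \<and> penalty X Z = lasry_lions P \<epsilon> V X"] minimizer_exists[OF assms]
  unfolding minimizer_def by auto

text \<open>Translating the minimizer for \<open>X\<close> by \<open>Y - X\<close> keeps the
  quadratic term, so only the Lipschitz bound of the sup-convolution is paid.\<close>

lemma lasry_lions_Lip_le:
  assumes X: "X \<in> \<H>" and Y: "Y \<in> \<H>"
  shows "lasry_lions P \<epsilon> V Y \<le> lasry_lions P \<epsilon> V X + L * L2_dist P Y X"
proof -
  let ?Z = "minimizer X"
  let ?W = "\<lambda>\<omega>. ?Z \<omega> + (Y \<omega> - X \<omega>)"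
  have Z: "?Z \<in> \<H>" by (rule minimizer_L2[OF X])
  then have W: "?W \<in> \<H>" using X Y by simp
  have "lasry_lions P \<epsilon> V Y \<le> sup_conv P \<epsilon> V ?W + 1 / \<epsilon> * (L2_dist P ?Z X)\<^sup>2"
    using lasry_lions_le[OF Y W] by (simp add: penalty_def)
  then show ?thesis
    using sup_conv_Lip_le[OF W Z] penalty_minimizer[OF X] by (simp add: penalty_def)
qed

lemma lasry_lions_Lip:
  assumes "X \<in> \<H>" "Y \<in> \<H>"
  shows "\<bar>lasry_lions P \<epsilon> V X - lasry_lions P \<epsilon> V Y\<bar> \<le> L * L2_dist P X Y"
  using lasry_lions_Lip_le[OF assms] lasry_lions_Lip_le[OF assms(2,1)]
  by (simp add: L2_norm_minus_commute[of P Y] abs_le_iff)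

text \<open>Each minimizer is tested against the other. On adding the two estimates the
  sup-convolutions cancel and the four squares collapse to an inner product with
  \<open>Y - X\<close>. The constant 4 is \<open>2 / \<epsilon>\<close> divided by
  \<open>1 / (2 * \<epsilon>)\<close>.\<close>

lemma minimizer_Lip:
  assumes X: "X \<in> \<H>" and Y: "Y \<in> \<H>"
  shows "L2_dist P (minimizer X) (minimizer Y) \<le> 4 * L2_dist P X Y"
proof -
  let ?Z = "minimizer X" and ?W = "minimizer Y"
  have Z: "?Z \<in> \<H>" and W: "?W \<in> \<H>" using X Y by (auto intro: minimizer_L2)
  have "1 / (8 * \<epsilon>) * (L2_dist P ?Z ?W)\<^sup>2 \<le> (penalty X ?W - penalty X ?Z) / 2"
    using penalty_midpoint[OF X Z W] penalty_minimizer[OF X] by argo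
  moreover have "1 / (8 * \<epsilon>) * (L2_dist P ?Z ?W)\<^sup>2 \<le> (penalty Y ?Z - penalty Y ?W) / 2"
    using penalty_midpoint[OF Y Z W] penalty_minimizer[OF Y] by argo
  moreover have "1 / (2 * \<epsilon>) * (L2_dist P ?Z ?W)\<^sup>2 = 4 * (1 / (8 * \<epsilon>) * (L2_dist P ?Z ?W)\<^sup>2)"
    by simp
  ultimately have "1 / (2 * \<epsilon>) * (L2_dist P ?Z ?W)\<^sup>2
      \<le> (penalty X ?W - penalty X ?Z) + (penalty Y ?Z - penalty Y ?W)"
    by argo
  also have "\<dots>
      = 1 / \<epsilon> * ((L2_dist P ?W X)\<^sup>2 - (L2_dist P ?Z X)\<^sup>2 + (L2_dist P ?Z Y)\<^sup>2 - (L2_dist P ?W Y)\<^sup>2)"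
    unfolding penalty_def by (simp add: algebra_simps)
  also have "(L2_dist P ?W X)\<^sup>2 - (L2_dist P ?Z X)\<^sup>2 + (L2_dist P ?Z Y)\<^sup>2 - (L2_dist P ?W Y)\<^sup>2
      = 2 * L2_inner P (\<lambda>\<omega>. ?W \<omega> - ?Z \<omega>) (\<lambda>\<omega>. Y \<omega> - X \<omega>)"
  proof -
    have "L2_inner P (\<lambda>\<omega>. (X \<omega> - ?Z \<omega>) - (X \<omega> - ?W \<omega>)) (\<lambda>\<omega>. Y \<omega> - X \<omega>)
       = L2_inner P (\<lambda>\<omega>. X \<omega> - ?Z \<omega>) (\<lambda>\<omega>. Y \<omega> - X \<omega>) - L2_inner P (\<lambda>\<omega>. X \<omega> - ?W \<omega>) (\<lambda>\<omega>. Y \<omega> - X \<omega>)"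
      using X Y Z W by (intro L2_inner_diff_left) auto
    then show ?thesis
      using L2_dist_sq_shift[OF X Y Z] L2_dist_sq_shift[OF X Y W] by simp
  qed
  also have "\<dots> \<le> 2 * (L2_dist P ?Z ?W * L2_dist P X Y)"
    using L2_Cauchy_Schwarz[of "\<lambda>\<omega>. ?W \<omega> - ?Z \<omega>" P "\<lambda>\<omega>. Y \<omega> - X \<omega>"] X Y Z W
    by (simp add: L2_norm_minus_commute[of P ?W] L2_norm_minus_commute[of P Y])
  finally have "L2_dist P ?Z ?W * L2_dist P ?Z ?W \<le> L2_dist P ?Z ?W * (4 * L2_dist P X Y)"
    using eps_pos by (simp add: field_simps power2_eq_square)
  then show ?thesis
    using L2_norm_nonneg[of P "\<lambda>\<omega>. ?Z \<omega> - ?W \<omega>"] by (cases "L2_dist P ?Z ?W = 0") auto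
qed

text \<open>Envelope formula: the derivative of the outer quadratic in \<open>X\<close> with the
  minimizer frozen.\<close>

definition gradient :: "('w \<Rightarrow> 'a) \<Rightarrow> 'w \<Rightarrow> 'a" where
  "gradient X = (\<lambda>\<omega>. (2 / \<epsilon>) *\<^sub>R (X \<omega> - minimizer X \<omega>))"

lemma gradient_L2: "X \<in> \<H> \<Longrightarrow> gradient X \<in> \<H>"
  unfolding gradient_def by (intro L2_space_scaleR L2_space_diff minimizer_L2)

text \<open>The constant is \<open>2 * (1 + 4)\<close>, from the identity and
  \<open>minimizer_Lip\<close>.\<close>

lemma gradient_Lip:
  assumes X: "X \<in> \<H>" and Y: "Y \<in> \<H>"
  shows "L2_dist P (gradient X) (gradient Y) \<le> 10 / \<epsilon> * L2_dist P X Y"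
proof -
  let ?Z = "minimizer X" and ?W = "minimizer Y"
  have Z: "?Z \<in> \<H>" and W: "?W \<in> \<H>" using X Y by (auto intro: minimizer_L2)
  have "L2_norm P (\<lambda>\<omega>. (X \<omega> - Y \<omega>) + (?W \<omega> - ?Z \<omega>)) \<le> L2_dist P X Y + L2_dist P ?W ?Z"
    using X Y Z W by (intro L2_norm_triangle) auto
  then have *: "L2_norm P (\<lambda>\<omega>. (X \<omega> - Y \<omega>) + (?W \<omega> - ?Z \<omega>)) \<le> 5 * L2_dist P X Y"
    using minimizer_Lip[OF X Y] by (simp add: L2_norm_minus_commute[of P ?W])
  have "(\<lambda>\<omega>. gradient X \<omega> - gradient Y \<omega>) = (\<lambda>\<omega>. (2 / \<epsilon>) *\<^sub>R ((X \<omega> - Y \<omega>) + (?W \<omega> - ?Z \<omega>)))"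
    by (simp add: gradient_def algebra_simps)
  then have "L2_dist P (gradient X) (gradient Y) = 2 / \<epsilon> * L2_norm P (\<lambda>\<omega>. (X \<omega> - Y \<omega>) + (?W \<omega> - ?Z \<omega>))"
    using eps_pos by (simp only: L2_norm_scaleR) simp
  also have "\<dots> \<le> 2 / \<epsilon> * (5 * L2_dist P X Y)"
    using eps_pos * by (intro mult_left_mono) auto
  finally show ?thesis by simp
qed

text \<open>The minimizer for \<open>X\<close> is a competitor at \<open>Y\<close>, and the
  objective is exactly quadratic in the base point.\<close>

lemma lasry_lions_upper_expansion:
  assumes X: "X \<in> \<H>" and Y: "Y \<in> \<H>"
  shows "lasry_lions P \<epsilon> V Y
    \<le> lasry_lions P \<epsilon> V X + L2_inner P (gradient X) (\<lambda>\<omega>. Y \<omega> - X \<omega>) + 1 / \<epsilon> * (L2_dist P Y X)\<^sup>2"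
proof -
  let ?Z = "minimizer X"
  have Z: "?Z \<in> \<H>" by (rule minimizer_L2[OF X])
  have "lasry_lions P \<epsilon> V Y \<le> penalty Y ?Z" by (rule lasry_lions_le[OF Y Z])
  also have "\<dots> = penalty X ?Z + L2_inner P (gradient X) (\<lambda>\<omega>. Y \<omega> - X \<omega>) + 1 / \<epsilon> * (L2_dist P Y X)\<^sup>2"
    using L2_dist_sq_shift[OF X Y Z]
    by (simp add: penalty_def gradient_def L2_inner_scaleR_left distrib_left)
  finally show ?thesis using penalty_minimizer[OF X] by simp
qed

text \<open>The lower bound is the upper expansion with \<open>X\<close> and \<open>Y\<close>
  exchanged. Replacing the gradient at \<open>Y\<close> by the one at \<open>X\<close> costs 10, and
  the quadratic term adds 1.\<close>

lemma lasry_lions_expansion: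
  assumes X: "X \<in> \<H>" and Y: "Y \<in> \<H>"
  shows "\<bar>lasry_lions P \<epsilon> V Y - lasry_lions P \<epsilon> V X - L2_inner P (gradient X) (\<lambda>\<omega>. Y \<omega> - X \<omega>)\<bar>
    \<le> 11 / \<epsilon> * (L2_dist P Y X)\<^sup>2"
proof -
  have G: "gradient X \<in> \<H>" "gradient Y \<in> \<H>"
    using X Y by (auto intro: gradient_L2)
  have "L2_inner P (gradient Y) (\<lambda>\<omega>. X \<omega> - Y \<omega>) = - L2_inner P (gradient Y) (\<lambda>\<omega>. Y \<omega> - X \<omega>)"
    using L2_inner_scaleR_right[of P "gradient Y" "-1" "\<lambda>\<omega>. Y \<omega> - X \<omega>"] by simp
  moreover have "L2_inner P (\<lambda>\<omega>. gradient X \<omega> - gradient Y \<omega>) (\<lambda>\<omega>. Y \<omega> - X \<omega>)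
     = L2_inner P (gradient X) (\<lambda>\<omega>. Y \<omega> - X \<omega>) - L2_inner P (gradient Y) (\<lambda>\<omega>. Y \<omega> - X \<omega>)"
    using G X Y by (intro L2_inner_diff_left) auto
  moreover have "\<bar>L2_inner P (\<lambda>\<omega>. gradient X \<omega> - gradient Y \<omega>) (\<lambda>\<omega>. Y \<omega> - X \<omega>)\<bar>
     \<le> L2_dist P (gradient X) (gradient Y) * L2_dist P Y X"
    using G X Y by (intro L2_Cauchy_Schwarz) auto
  moreover have "L2_dist P (gradient X) (gradient Y) * L2_dist P Y X \<le> 10 / \<epsilon> * (L2_dist P Y X)\<^sup>2"
    using mult_right_mono[OF gradient_Lip[OF X Y], of "L2_dist P Y X"]
    by (simp add: power2_eq_square L2_norm_minus_commute[of P X])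
  moreover have "0 \<le> 1 / \<epsilon> * (L2_dist P Y X)\<^sup>2" using eps_pos by simp
  moreover have "11 / \<epsilon> * (L2_dist P Y X)\<^sup>2 = 10 / \<epsilon> * (L2_dist P Y X)\<^sup>2 + 1 / \<epsilon> * (L2_dist P Y X)\<^sup>2"
    by (simp add: field_simps)
  ultimately show ?thesis
    using lasry_lions_upper_expansion[OF X Y] lasry_lions_upper_expansion[OF Y X]
      L2_norm_minus_commute[of P X Y] by (simp only: abs_le_iff) linarith
qed

text \<open>Stated for any \<open>W\<close> that agrees on \<open>\<H>\<close>, since the lift of
  the descended functional is known only there.\<close>

lemma L2_C11_lasry_lions:
  assumes eq: "\<And>X. X \<in> \<H> \<Longrightarrow> W X = lasry_lions P \<epsilon> V X"
  shows "L2_C11 P W"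
  unfolding L2_C11_def
proof (intro exI[of _ gradient] conjI exI[of _ "10 / \<epsilon>"] ballI)
  show "0 \<le> 10 / \<epsilon>" using eps_pos by simp
  fix X assume X: "X \<in> \<H>"
  show "has_L2_gradient P W (gradient X) X"
    unfolding has_L2_gradient_def
  proof (intro conjI allI impI)
    fix e :: real assume e: "0 < e"
    show "\<exists>\<delta>>0. \<forall>Y\<in>\<H>. L2_dist P Y X < \<delta> \<longrightarrow>
        \<bar>W Y - W X - L2_inner P (gradient X) (\<lambda>\<omega>. Y \<omega> - X \<omega>)\<bar> \<le> e * L2_dist P Y X"
    \<comment> \<open>The radius makes \<open>11 / \<epsilon>\<close> times the distance at most
      \<open>e\<close>.\<close>
    proof (intro exI[of _ "e * \<epsilon> / 11"] conjI ballI impI)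
      show "0 < e * \<epsilon> / 11" using e eps_pos by simp
      fix Y assume Y: "Y \<in> \<H>" and lt: "L2_dist P Y X < e * \<epsilon> / 11"
      have "11 / \<epsilon> * (L2_dist P Y X)\<^sup>2 = (11 / \<epsilon> * L2_dist P Y X) * L2_dist P Y X"
        by (simp add: power2_eq_square)
      also have "\<dots> \<le> e * L2_dist P Y X"
        using lt eps_pos by (intro mult_right_mono) (auto simp: field_simps)
      finally show "\<bar>W Y - W X - L2_inner P (gradient X) (\<lambda>\<omega>. Y \<omega> - X \<omega>)\<bar> \<le> e * L2_dist P Y X"
        using lasry_lions_expansion[OF X Y] eq[OF X] eq[OF Y] by simp
    qed
  qed (rule gradient_L2[OF X])
qed (use gradient_Lip in auto)

section \<open>Preservation of convexity\<close>

text \<open>A competitor \<open>Y\<close> at the combined point has an offset \<open>H\<close>.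
  Shifting both \<open>Z\<close> and \<open>W\<close> by this same offset costs the same penalty,
  and \<open>Y\<close> is the convex combination of the shifted points.\<close>

lemma sup_conv_convex:
  assumes convex: "\<And>X Y. X \<in> \<H> \<Longrightarrow> Y \<in> \<H> \<Longrightarrow>
      V (\<lambda>\<omega>. (1 - t) *\<^sub>R X \<omega> + t *\<^sub>R Y \<omega>) \<le> (1 - t) * V X + t * V Y"
    and t: "t \<in> {0..1}" and Z: "Z \<in> \<H>" and W: "W \<in> \<H>"
  shows "sup_conv P \<epsilon> V (\<lambda>\<omega>. (1 - t) *\<^sub>R Z \<omega> + t *\<^sub>R W \<omega>) \<le> (1 - t) * sup_conv P \<epsilon> V Z + t * sup_conv P \<epsilon> V W"
    (is "sup_conv P \<epsilon> V ?M \<le> _")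
proof (rule sup_conv_least)
  fix Y assume Y: "Y \<in> \<H>"
  define H where "H = (\<lambda>\<omega>. ?M \<omega> - Y \<omega>)"
  have H: "H \<in> \<H>" unfolding H_def using Z W Y by (intro L2_space_diff L2_space_convex)
  let ?c = "1 / (2 * \<epsilon>) * (L2_norm P H)\<^sup>2"
  have "V (\<lambda>\<omega>. Z \<omega> - H \<omega>) - ?c \<le> sup_conv P \<epsilon> V Z"
    using sup_conv_upper[of "\<lambda>\<omega>. Z \<omega> - H \<omega>" Z] Z H by simp
  then have 1: "(1 - t) * (V (\<lambda>\<omega>. Z \<omega> - H \<omega>) - ?c) \<le> (1 - t) * sup_conv P \<epsilon> V Z"
    using t by (intro mult_left_mono) auto
  have "V (\<lambda>\<omega>. W \<omega> - H \<omega>) - ?c \<le> sup_conv P \<epsilon> V W"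
    using sup_conv_upper[of "\<lambda>\<omega>. W \<omega> - H \<omega>" W] W H by simp
  then have 2: "t * (V (\<lambda>\<omega>. W \<omega> - H \<omega>) - ?c) \<le> t * sup_conv P \<epsilon> V W"
    using t by (intro mult_left_mono) auto
  have "Y = (\<lambda>\<omega>. (1 - t) *\<^sub>R (Z \<omega> - H \<omega>) + t *\<^sub>R (W \<omega> - H \<omega>))"
    by (rule ext) (simp add: H_def algebra_simps)
  then have "V Y \<le> (1 - t) * V (\<lambda>\<omega>. Z \<omega> - H \<omega>) + t * V (\<lambda>\<omega>. W \<omega> - H \<omega>)"
    using convex[of "\<lambda>\<omega>. Z \<omega> - H \<omega>" "\<lambda>\<omega>. W \<omega> - H \<omega>"] Z W H by simp
  moreover have "(1 - t) * (V (\<lambda>\<omega>. Z \<omega> - H \<omega>) - ?c) + t * (V (\<lambda>\<omega>. W \<omega> - H \<omega>) - ?c)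
     = (1 - t) * V (\<lambda>\<omega>. Z \<omega> - H \<omega>) + t * V (\<lambda>\<omega>. W \<omega> - H \<omega>) - ?c"
    by (simp add: algebra_simps diff_divide_distrib)
  ultimately show "V Y - 1 / (2 * \<epsilon>) * (L2_dist P ?M Y)\<^sup>2 \<le> (1 - t) * sup_conv P \<epsilon> V Z + t * sup_conv P \<epsilon> V W"
    using 1 2 unfolding H_def[symmetric] by linarith
qed

text \<open>The convex combination of the two minimizers is a competitor; the outer quadratic is
  jointly convex in both arguments.\<close>

lemma lasry_lions_convex:
  assumes convex: "\<And>X Y. X \<in> \<H> \<Longrightarrow> Y \<in> \<H> \<Longrightarrow>
      V (\<lambda>\<omega>. (1 - t) *\<^sub>R X \<omega> + t *\<^sub>R Y \<omega>) \<le> (1 - t) * V X + t * V Y"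
    and t: "t \<in> {0..1}" and X: "X \<in> \<H>" and Y: "Y \<in> \<H>"
  shows "lasry_lions P \<epsilon> V (\<lambda>\<omega>. (1 - t) *\<^sub>R X \<omega> + t *\<^sub>R Y \<omega>)
    \<le> (1 - t) * lasry_lions P \<epsilon> V X + t * lasry_lions P \<epsilon> V Y" (is "lasry_lions P \<epsilon> V ?M \<le> _")
proof -
  let ?Z = "minimizer X" and ?W = "minimizer Y"
  let ?N = "\<lambda>\<omega>. (1 - t) *\<^sub>R ?Z \<omega> + t *\<^sub>R ?W \<omega>"
  have Z: "?Z \<in> \<H>" and W: "?W \<in> \<H>" using X Y by (auto intro: minimizer_L2)
  have "(\<lambda>\<omega>. ?N \<omega> - ?M \<omega>) = (\<lambda>\<omega>. (1 - t) *\<^sub>R (?Z \<omega> - X \<omega>) + t *\<^sub>R (?W \<omega> - Y \<omega>))"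
    by (simp add: algebra_simps)
  then have "(L2_dist P ?N ?M)\<^sup>2 = (1 - t) * (L2_dist P ?Z X)\<^sup>2 + t * (L2_dist P ?W Y)\<^sup>2
      - t * (1 - t) * (L2_norm P (\<lambda>\<omega>. (?Z \<omega> - X \<omega>) - (?W \<omega> - Y \<omega>)))\<^sup>2"
    using X Y Z W L2_norm_convex_sq[of "\<lambda>\<omega>. ?Z \<omega> - X \<omega>" P "\<lambda>\<omega>. ?W \<omega> - Y \<omega>" t] by simp
  also have "\<dots> \<le> (1 - t) * (L2_dist P ?Z X)\<^sup>2 + t * (L2_dist P ?W Y)\<^sup>2"
    using t by simp
  finally have "1 / \<epsilon> * (L2_dist P ?N ?M)\<^sup>2 \<le> 1 / \<epsilon> * ((1 - t) * (L2_dist P ?Z X)\<^sup>2 + t * (L2_dist P ?W Y)\<^sup>2)"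
    using eps_pos by (intro mult_left_mono) auto
  moreover have "lasry_lions P \<epsilon> V ?M \<le> penalty ?M ?N"
    using X Y Z W by (intro lasry_lions_le L2_space_convex)
  moreover have "sup_conv P \<epsilon> V ?N \<le> (1 - t) * sup_conv P \<epsilon> V ?Z + t * sup_conv P \<epsilon> V ?W"
    by (rule sup_conv_convex[OF convex t Z W])
  moreover have "(1 - t) * penalty X ?Z + t * penalty Y ?W
    = (1 - t) * sup_conv P \<epsilon> V ?Z + t * sup_conv P \<epsilon> V ?W
      + 1 / \<epsilon> * ((1 - t) * (L2_dist P ?Z X)\<^sup>2 + t * (L2_dist P ?W Y)\<^sup>2)"
    by (simp add: penalty_def algebra_simps diff_divide_distrib)
  ultimately have "lasry_lions P \<epsilon> V ?M \<le> (1 - t) * penalty X ?Z + t * penalty Y ?W"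
    unfolding penalty_def[of ?M] by linarith
  then show ?thesis using penalty_minimizer X Y by simp
qed

end

section \<open>Invariance in law from approximate rearrangement\<close>

text \<open>Letting the slack tend to zero turns approximate distances of rearranged competitors
  into an exact inequality.\<close>

lemma le_of_square_perturbation:
  fixes a b c d :: real
  assumes "0 \<le> c" and "0 \<le> d"
    and approx: "\<And>\<delta>. 0 < \<delta> \<Longrightarrow> \<exists>d'\<ge>0. d' \<le> d + \<delta> \<and> a \<le> b + c * d'\<^sup>2"
  shows "a \<le> b + c * d\<^sup>2"
proof (rule tendsto_lowerbound)
  show "((\<lambda>\<delta>. b + c * (d + \<delta>)\<^sup>2) \<longlongrightarrow> b + c * d\<^sup>2) (at_right 0)"
    by (auto intro!: tendsto_eq_intros)
  show "\<forall>\<^sub>F \<delta> in at_right 0. a \<le> b + c * (d + \<delta>)\<^sup>2"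
    unfolding eventually_at_right_field
  proof (intro exI[of _ 1] conjI allI impI)
    fix \<delta> :: real assume "0 < \<delta>"
    from approx[OF this] obtain d' where "0 \<le> d'" "d' \<le> d + \<delta>" "a \<le> b + c * d'\<^sup>2" by auto
    moreover from this have "c * d'\<^sup>2 \<le> c * (d + \<delta>)\<^sup>2"
      using \<open>0 \<le> c\<close> by (intro mult_left_mono power_mono) auto
    ultimately show "a \<le> b + c * (d + \<delta>)\<^sup>2" by linarith
  qed simp
qed simp

text \<open>\<open>rearrange\<close> isolates what invariance requires of the sample space. Its
  slack comes from replacing \<open>X\<close> by a countably valued approximation.\<close>

locale law_invariant_functional = lipschitz_functional +
  assumes law_invariant: "X \<in> \<H> \<Longrightarrow> Y \<in> \<H> \<Longrightarrow> distr P borel X = distr P borel Y \<Longrightarrow> V X = V Y"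
    and rearrange: "X \<in> \<H> \<Longrightarrow> X' \<in> \<H> \<Longrightarrow> Y \<in> \<H> \<Longrightarrow>
      distr P borel X = distr P borel X' \<Longrightarrow> 0 < \<delta> \<Longrightarrow>
      \<exists>Y'\<in>\<H>. distr P borel Y' = distr P borel Y \<and> L2_dist P X' Y' \<le> L2_dist P X Y + \<delta>"
begin

text \<open>A rearranged competitor has the law of \<open>Y\<close>, hence the same value of
  \<open>V\<close>, at almost the same distance.\<close>

lemma sup_conv_law_le:
  assumes X: "X \<in> \<H>" and X': "X' \<in> \<H>" and eq: "distr P borel X = distr P borel X'"
  shows "sup_conv P \<epsilon> V X \<le> sup_conv P \<epsilon> V X'"
proof (rule sup_conv_least)
  fix Y assume Y: "Y \<in> \<H>"
  have "V Y \<le> sup_conv P \<epsilon> V X' + 1 / (2 * \<epsilon>) * (L2_dist P X Y)\<^sup>2"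
  proof (rule le_of_square_perturbation)
    fix \<delta> :: real assume "0 < \<delta>"
    from rearrange[OF X X' Y eq this] obtain Y' where Y': "Y' \<in> \<H>"
      "distr P borel Y' = distr P borel Y" "L2_dist P X' Y' \<le> L2_dist P X Y + \<delta>" by auto
    then show "\<exists>d'\<ge>0. d' \<le> L2_dist P X Y + \<delta> \<and> V Y \<le> sup_conv P \<epsilon> V X' + 1 / (2 * \<epsilon>) * d'\<^sup>2"
      using sup_conv_upper[OF Y'(1) X'] law_invariant[OF Y'(1) Y Y'(2)]
      by (intro exI[of _ "L2_dist P X' Y'"]) auto
  qed (use eps_pos in auto)
  then show "V Y - 1 / (2 * \<epsilon>) * (L2_dist P X Y)\<^sup>2 \<le> sup_conv P \<epsilon> V X'" by linarith
qed

text \<open>Now \<open>Z\<close> is rearranged; the sup-convolution does not increase because it was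
  already compared along equal laws.\<close>

lemma lasry_lions_law_le:
  assumes X: "X \<in> \<H>" and X': "X' \<in> \<H>" and eq: "distr P borel X = distr P borel X'"
  shows "lasry_lions P \<epsilon> V X' \<le> lasry_lions P \<epsilon> V X"
  unfolding lasry_lions_eq_INF[of X]
proof (rule cINF_greatest)
  fix Z assume Z: "Z \<in> \<H>"
  show "lasry_lions P \<epsilon> V X' \<le> penalty X Z"
    unfolding penalty_def
  proof (rule le_of_square_perturbation)
    fix \<delta> :: real assume "0 < \<delta>"
    from rearrange[OF X X' Z eq this] obtain Z' where Z': "Z' \<in> \<H>"
      "distr P borel Z' = distr P borel Z" "L2_dist P X' Z' \<le> L2_dist P X Z + \<delta>" by auto
    then show "\<exists>d'\<ge>0. d' \<le> L2_dist P Z X + \<delta> \<and> lasry_lions P \<epsilon> V X' \<le> sup_conv P \<epsilon> V Z + 1 / \<epsilon> * d'\<^sup>2"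
      using lasry_lions_le[OF X' Z'(1)] sup_conv_law_le[OF Z'(1) Z Z'(2)]
      by (intro exI[of _ "L2_dist P Z' X'"])
         (auto simp: penalty_def L2_norm_minus_commute[of P Z'] L2_norm_minus_commute[of P Z])
  qed (use eps_pos in auto)
qed simp

lemma lasry_lions_law_invariant:
  assumes "X \<in> \<H>" "X' \<in> \<H>" "distr P borel X = distr P borel X'"
  shows "lasry_lions P \<epsilon> V X = lasry_lions P \<epsilon> V X'"
  using lasry_lions_law_le[OF assms] lasry_lions_law_le[OF assms(2,1) assms(3)[symmetric]] by simp

end

section \<open>Realizing laws on a space without point masses\<close>

text \<open>The digits are 0 and 2 in base 3, so that expansions are unique and digits can be read
  off by a threshold.\<close>

definition ternary :: "(nat \<Rightarrow> bool) \<Rightarrow> real" where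
  "ternary b = (\<Sum>n. of_bool (b n) * 2 * (1/3) ^ Suc n)"

text \<open>The digit shift, extended by the threshold to a Borel map on all reals.\<close>

fun ternary_rest :: "real \<Rightarrow> nat \<Rightarrow> real" where
  "ternary_rest y 0 = y"
| "ternary_rest y (Suc n) = 3 * ternary_rest y n - (if 1/2 \<le> ternary_rest y n then 2 else 0)"

lemma summable_ternary: "summable (\<lambda>n. of_bool (b n) * 2 * (1/3 :: real) ^ Suc n)"
proof (rule summable_comparison_test')
  show "summable (\<lambda>n. 2 * (1/3 :: real) ^ Suc n)"
    by (intro summable_mult summable_Suc_iff[THEN iffD2] summable_geometric) auto
qed (auto simp: of_bool_def)

lemma ternary_split: "ternary b = of_bool (b 0) * 2 / 3 + ternary (\<lambda>n. b (Suc n)) / 3"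
proof -
  have "(\<Sum>n. of_bool (b (Suc n)) * 2 * (1/3) ^ Suc (Suc n)) = (\<Sum>n. (of_bool (b (Suc n)) * 2 * (1/3) ^ Suc n) / (3::real))"
    by (intro suminf_cong) simp
  also have "\<dots> = ternary (\<lambda>n. b (Suc n)) / 3"
    unfolding ternary_def by (rule suminf_divide) (rule summable_ternary)
  finally show ?thesis
    using suminf_split_head[OF summable_ternary[of b]] unfolding ternary_def by simp
qed

lemma ternary_bounds: "0 \<le> ternary b" "ternary b \<le> 1"
proof -
  show "0 \<le> ternary b"
    unfolding ternary_def by (intro suminf_nonneg summable_ternary) simp
  have sums: "(\<lambda>n. 2 * (1/3) * (1/3 :: real) ^ n) sums (2 * (1/3) * (1 / (1 - 1/3)))"
    by (intro sums_mult geometric_sums) simp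
  have "ternary b \<le> (\<Sum>n. 2 * (1/3) * (1/3 :: real) ^ n)"
    unfolding ternary_def using sums_summable[OF sums]
    by (intro suminf_le summable_ternary) (auto simp: of_bool_def)
  also have "\<dots> = 1" using sums_unique[OF sums] by simp
  finally show "ternary b \<le> 1" .
qed

text \<open>A first digit 0 gives a value at most 1/3, a first digit 2 a value at least 2/3.\<close>

lemma ternary_half_le_iff: "1/2 \<le> ternary b \<longleftrightarrow> b 0"
  using ternary_split[of b] ternary_bounds[of "\<lambda>n. b (Suc n)"] by (cases "b 0") auto

lemma ternary_rest_ternary: "ternary_rest (ternary b) n = ternary (\<lambda>k. b (k + n))"
proof (induction n)
  case (Suc n)
  show ?case
    using ternary_half_le_iff[of "\<lambda>k. b (k + n)"] ternary_split[of "\<lambda>k. b (k + n)"]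
    by (simp add: Suc)
qed simp

lemma ternary_bit: "1/2 \<le> ternary_rest (ternary b) n \<longleftrightarrow> b n"
  unfolding ternary_rest_ternary ternary_half_le_iff by simp

lemma borel_measurable_ternary_rest [measurable]: "(\<lambda>y. ternary_rest y n) \<in> borel_measurable borel"
  by (induction n) auto

section \<open>Borel codes for points of separable metric spaces\<close>

definition dense_seq :: "nat \<Rightarrow> 'a::{metric_space, second_countable_topology}" where
  "dense_seq = (SOME d. \<forall>x. \<forall>e>0. \<exists>n. dist x (d n) < e)"

lemma dense_seq: "0 < e \<Longrightarrow> \<exists>n. dist (x::'a::{metric_space, second_countable_topology}) (dense_seq n) < e"
proof -
  obtain D :: "'a set" where D: "countable D" "\<And>X. open X \<Longrightarrow> X \<noteq> {} \<Longrightarrow> \<exists>d\<in>D. d \<in> X"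
    using countable_dense_exists by blast
  have "D \<noteq> {}" using D(2)[of UNIV] by auto
  then have range: "range (from_nat_into D) = D" using D(1) by (rule range_from_nat_into)
  have "\<forall>x. \<forall>e>0. \<exists>n. dist x (from_nat_into D n) < e"
  proof (intro allI impI)
    fix x :: 'a and e :: real assume "0 < e"
    then obtain d where "d \<in> D" "d \<in> ball x e" using D(2)[of "ball x e"] by auto
    then show "\<exists>n. dist x (from_nat_into D n) < e" using range by (metis mem_ball rangeE)
  qed
  then have "\<forall>x::'a. \<forall>e>0. \<exists>n. dist x (dense_seq n) < e"
    unfolding dense_seq_def by (rule someI[where P="\<lambda>d. \<forall>x. \<forall>e>0. \<exists>n. dist x (d n) < e"])
  then show "0 < e \<Longrightarrow> ?thesis" by blast
qed

text \<open>Membership in these countably many balls separates points, which makes the code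
  injective as well as Borel.\<close>

definition real_code :: "'a::{metric_space, second_countable_topology} \<Rightarrow> real" where
  "real_code x = ternary (\<lambda>j. case prod_decode j of (m, k) \<Rightarrow> dist x (dense_seq m) < inverse (Suc k))"

lemma real_code_bit:
  "1/2 \<le> ternary_rest (real_code x) (prod_encode (m, k)) \<longleftrightarrow> dist x (dense_seq m) < inverse (Suc k)"
  unfolding real_code_def ternary_bit by simp

lemma inj_real_code: "inj real_code"
proof (rule injI)
  fix x y :: 'a assume eq: "real_code x = real_code y"
  have "dist x y \<le> 0 + e" if e: "0 < e" for e
  proof -
    obtain k where k: "inverse (real (Suc k)) < e / 2"
      using reals_Archimedean[OF half_gt_zero[OF e]] by blast
    obtain m where m: "dist x (dense_seq m) < inverse (Suc k)"
      using dense_seq[of "inverse (Suc k)" x] by auto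
    then have "dist y (dense_seq m) < inverse (Suc k)"
      using real_code_bit[of x m k] real_code_bit[of y m k] eq by simp
    then show ?thesis
      using m k dist_triangle2[of x y "dense_seq m"] by simp
  qed
  then show "x = y" using field_le_epsilon[of "dist x y" 0] by simp
qed

lemma borel_measurable_real_code [measurable]: "real_code \<in> borel_measurable borel"
proof -
  have "Measurable.pred borel (\<lambda>x. case prod_decode j of (m, k) \<Rightarrow> dist x (dense_seq m) < inverse (Suc k))" for j
    by (cases "prod_decode j") simp
  then show ?thesis
    unfolding real_code_def ternary_def of_bool_def by measurable
qed

text \<open>At each scale \<open>k\<close> the first dense point whose ball contains the coded point
  is taken. Off the range of \<open>real_code\<close>, \<open>LEAST\<close> and \<open>lim\<close>
  give arbitrary values, but the map is still Borel.\<close>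

definition real_decode :: "real \<Rightarrow> 'a::{banach, second_countable_topology}" where
  "real_decode y = lim (\<lambda>k. dense_seq (LEAST m. 1/2 \<le> ternary_rest y (prod_encode (m, k))))"

lemma borel_measurable_real_decode [measurable]: "real_decode \<in> borel_measurable borel"
  unfolding real_decode_def by measurable

lemma real_decode_code: "real_decode (real_code x) = x"
proof -
  let ?m = "\<lambda>k. LEAST m. 1/2 \<le> ternary_rest (real_code x) (prod_encode (m, k))"
  have "dist x (dense_seq (?m k)) < inverse (Suc k)" for k
    using LeastI_ex[of "\<lambda>m. 1/2 \<le> ternary_rest (real_code x) (prod_encode (m, k))"]
      dense_seq[of "inverse (Suc k)" x] unfolding real_code_bit by auto
  then have "(\<lambda>k. dense_seq (?m k)) \<longlonglongrightarrow> x"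
    by (intro metric_tendsto_imp_tendsto[OF LIMSEQ_inverse_real_of_nat] always_eventually allI)
       (simp add: dist_commute less_imp_le)
  then show ?thesis unfolding real_decode_def by (rule limI)
qed

section \<open>Probability integral transform and quantiles\<close>

text \<open>Absence of atoms makes the distribution function continuous, so every level strictly
  between 0 and 1 is attained; the end levels are treated apart.\<close>

lemma (in prob_space) cdf_transform:
  fixes X :: "'a \<Rightarrow> real"
  assumes [measurable]: "X \<in> borel_measurable M"
    and no_atom: "\<And>x. measure M {\<omega>\<in>space M. X \<omega> = x} = 0"
    and c: "0 \<le> c" "c \<le> 1"
  shows "measure M {\<omega>\<in>space M. cdf (distr M borel X) (X \<omega>) \<le> c} = c"
proof -
  let ?D = "distr M borel X"
  interpret D: cdf_distribution ?D
    unfolding cdf_distribution_def by (rule real_distribution_distr) simp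
  let ?S = "\<lambda>c. {\<omega>\<in>space M. D.C (X \<omega>) \<le> c}"
  have [measurable]: "?S c \<in> sets M" for c by measurable
  have cont: "isCont D.C x" for x
    using no_atom[of x] by (simp add: D.isCont_cdf measure_distr vimage_def Int_def conj_commute)
  have main: "measure M (?S u) = u" if u: "0 < u" "u < 1" for u
  proof -
    have "{x. u < D.C x} \<noteq> {} \<and> bdd_below {x. u < D.C x}"
    proof
      show "{x. u < D.C x} \<noteq> {}"
        using order_tendstoD(1)[OF D.top u(2)] by (auto dest!: eventually_happens'[OF trivial_limit_at_top_linorder])
      obtain y where "D.C y < u"
        by (metis eventually_happens' trivial_limit_at_bot_linorder order_tendstoD(2) D.bot u(1))
      then have "y \<le> x" if "u < D.C x" for x
        using that D.cdf_nondecreasing[of x y] by (cases "y \<le> x") auto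
      then show "bdd_below {x. u < D.C x}" by (intro bdd_belowI[of _ y]) auto
    qed
    note ne = conjunct1[OF this] and bdd = conjunct2[OF this]
    \<comment> \<open>The strict inequality selects the right end of the plateau at level
      \<open>u\<close>, so that \<open>D.C x \<le> u\<close> is equivalent to
      \<open>x \<le> t\<close>.\<close>
    define t where "t = Inf {x. u < D.C x}"
    have below: "D.C x \<le> u" if "x < t" for x
      using that cInf_lower[OF _ bdd, of x] unfolding t_def by (cases "u < D.C x") auto
    have above: "u < D.C x" if "t < x" for x
    proof -
      obtain z where "u < D.C z" "z < x" using cInf_lessD[OF ne, of x] \<open>t < x\<close> unfolding t_def by auto
      then show ?thesis using D.cdf_nondecreasing[of z x] by simp
    qed
    have "D.C t \<le> u"
    proof (rule tendsto_upperbound)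
      show "(D.C \<longlongrightarrow> D.C t) (at_left t)"
        using cont[of t] by (simp add: isCont_def filterlim_at_split)
      show "\<forall>\<^sub>F x in at_left t. D.C x \<le> u"
        using below by (auto simp: eventually_at_left_field intro!: exI[of _ "t - 1"])
    qed simp
    moreover have "u \<le> D.C t"
    proof (rule tendsto_lowerbound)
      show "(D.C \<longlongrightarrow> D.C t) (at_right t)"
        using cont[of t] by (simp add: isCont_def filterlim_at_split)
      show "\<forall>\<^sub>F x in at_right t. u \<le> D.C x"
        using above by (auto simp: eventually_at_right_field less_imp_le intro!: exI[of _ "t + 1"])
    qed simp
    ultimately have eq: "D.C t = u" by simp
    have "D.C x \<le> u \<longleftrightarrow> x \<le> t" for x
      using above[of x] eq D.cdf_nondecreasing[of x t] by (cases "x \<le> t") auto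
    then have "?S u = X -` {..t} \<inter> space M" by auto
    then have "measure M (?S u) = measure ?D {..t}"
      by (simp add: measure_distr)
    then show ?thesis using eq by (simp add: cdf_def)
  qed
  consider "c = 0" | "0 < c" "c < 1" | "c = 1" using c by linarith
  then show ?thesis
  proof cases
    case 1
    \<comment> \<open>At level 0 the set defining \<open>t\<close> may be unbounded below, so small
      positive levels are used instead.\<close>
    have "measure M (?S 0) \<le> 0 + e" if "0 < e" for e
    proof -
      define u where "u = min e (1/2)"
      have "measure M (?S 0) \<le> measure M (?S u)"
        using that by (intro finite_measure_mono) (auto simp: u_def)
      also have "\<dots> = u" using that by (intro main) (auto simp: u_def)
      finally show ?thesis by (simp add: u_def)
    qed
    then have "measure M (?S 0) \<le> 0" by (rule field_le_epsilon)
    then show ?thesis using 1 measure_nonneg[of M "?S 0"] by simp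
  next
    case 3
    then have "?S c = space M" using D.cdf_bounded_prob by auto
    then show ?thesis using 3 prob_space by simp
  qed (rule main)
qed

text \<open>The quantile function \<open>N.I\<close> of the target law is applied to a uniform
  variable obtained from \<open>X\<close>.\<close>

lemma (in prob_space) realize_real:
  fixes X :: "'a \<Rightarrow> real"
  assumes [measurable]: "X \<in> borel_measurable M"
    and no_atom: "\<And>x. measure M {\<omega>\<in>space M. X \<omega> = x} = 0"
    and \<nu>: "real_distribution \<nu>"
  shows "\<exists>Y\<in>borel_measurable M. distr M borel Y = \<nu>"
proof -
  interpret N: cdf_distribution \<nu>
    unfolding cdf_distribution_def by (rule \<nu>)
  define U where "U \<omega> = cdf (distr M borel X) (X \<omega>)" for \<omega>
  interpret D: cdf_distribution "distr M borel X"
    unfolding cdf_distribution_def by (rule real_distribution_distr) simp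
  have U [measurable]: "U \<in> borel_measurable M" unfolding U_def by measurable
  have U_le: "measure M {\<omega>\<in>space M. U \<omega> \<le> c} = c" if "0 \<le> c" "c \<le> 1" for c
    unfolding U_def by (rule cdf_transform) (use no_atom that in auto)
  have "AE \<omega> in M. \<not> U \<omega> \<le> 0"
    using U_le[of 0] by (subst AE_iff_measurable[OF _ refl]) (auto simp: emeasure_eq_measure)
  moreover have "AE \<omega> in M. U \<omega> < 1"
  proof -
    \<comment> \<open>The law of \<open>U\<close> is known on closed sublevel sets, so the open one
      is exhausted by the levels \<open>1 - e\<close>.\<close>
    have "1 \<le> measure M {\<omega>\<in>space M. U \<omega> < 1} + e" if "0 < e" for e
    proof (cases "e < 1")
      case True
      then have "1 - e = measure M {\<omega>\<in>space M. U \<omega> \<le> 1 - e}" using that by (simp add: U_le)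
      also have "\<dots> \<le> measure M {\<omega>\<in>space M. U \<omega> < 1}"
        using that by (intro finite_measure_mono) auto
      finally show ?thesis by simp
    next
      case False
      then show ?thesis using measure_nonneg[of M "{\<omega>\<in>space M. U \<omega> < 1}"] by linarith
    qed
    then have "1 \<le> measure M {\<omega>\<in>space M. U \<omega> < 1}" by (rule field_le_epsilon)
    then have "measure M {\<omega>\<in>space M. U \<omega> < 1} = 1"
      using prob_le_1[of "{\<omega>\<in>space M. U \<omega> < 1}"] by simp
    then show ?thesis by (simp add: prob_Collect_eq_1)
  qed
  ultimately have U01: "AE \<omega> in M. 0 < U \<omega> \<and> U \<omega> < 1" by eventually_elim auto
  \<comment> \<open>The pseudoinverse relation is used only inside the open unit interval, where
    \<open>U\<close> lies almost everywhere; the value 0 elsewhere gives a Borel map on the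
    line.\<close>
  define q where "q u = indicator {0<..<1} u *\<^sub>R N.I u" for u
  have [measurable]: "q \<in> borel_measurable borel"
    unfolding q_def using N.measurable_CI by (subst (asm) borel_measurable_restrict_space_iff) auto
  let ?Y = "\<lambda>\<omega>. q (U \<omega>)"
  have "distr M borel ?Y = \<nu>"
  proof (intro cdf_unique ext)
    show "real_distribution (distr M borel ?Y)" by (rule real_distribution_distr) simp
    show "real_distribution \<nu>" by (rule \<nu>)
    fix x
    have "cdf (distr M borel ?Y) x = measure M {\<omega>\<in>space M. q (U \<omega>) \<le> x}"
      by (simp add: cdf_def measure_distr vimage_def Int_def conj_commute)
    also have "\<dots> = measure M {\<omega>\<in>space M. U \<omega> \<le> N.C x}"
    proof (rule measure_eq_AE)
      show "AE \<omega> in M. \<omega> \<in> {\<omega>\<in>space M. q (U \<omega>) \<le> x} \<longleftrightarrow> \<omega> \<in> {\<omega>\<in>space M. U \<omega> \<le> N.C x}"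
        using U01 by eventually_elim (simp add: q_def N.pseudoinverse[symmetric])
    qed measurable
    also have "\<dots> = N.C x" by (rule U_le) (auto simp: N.cdf_nonneg N.cdf_bounded_prob)
    finally show "cdf (distr M borel ?Y) x = cdf \<nu> x" .
  qed
  then show ?thesis by (intro bexI[of _ ?Y]) auto
qed

text \<open>Fibres of the injective \<open>c\<close> are at most single null points, so
  \<open>c\<close> has no atoms. The target law is moved to the reals by \<open>real_code\<close>,
  realized there and decoded.\<close>

lemma (in prob_space) realize_law:
  fixes \<mu> :: "'b::{banach, second_countable_topology} measure"
  assumes [measurable]: "(c :: 'a \<Rightarrow> real) \<in> borel_measurable M" and inj: "inj_on c (space M)"
    and no_atom: "\<And>x. x \<in> space M \<Longrightarrow> emeasure M {x} = 0"
    and \<mu>: "prob_space \<mu>" "sets \<mu> = sets borel"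
  shows "\<exists>Y\<in>borel_measurable M. distr M borel Y = \<mu>"
proof -
  interpret \<mu>: prob_space \<mu> by fact
  note [measurable_cong] = \<mu>(2)
  have no_fibre: "measure M {\<omega>\<in>space M. c \<omega> = x} = 0" for x
  proof (cases "\<exists>\<omega>\<in>space M. c \<omega> = x")
    case True
    then obtain \<omega> where "\<omega> \<in> space M" "c \<omega> = x" by auto
    then have "{\<omega>\<in>space M. c \<omega> = x} = {\<omega>}" using inj by (auto dest: inj_onD)
    then show ?thesis using no_atom[OF \<open>\<omega> \<in> space M\<close>] by (simp add: measure_def)
  next
    case False
    then have "{\<omega>\<in>space M. c \<omega> = x} = {}" by auto
    then show ?thesis by (simp only: measure_empty)
  qed
  obtain Y where [measurable]: "Y \<in> borel_measurable M"
    and Y: "distr M borel Y = distr \<mu> borel real_code"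
    using realize_real[OF assms(1) no_fibre \<mu>.real_distribution_distr[of real_code]] by auto
  have "distr M borel (\<lambda>\<omega>. real_decode (Y \<omega>)) = distr (distr M borel Y) borel real_decode"
    by (simp add: distr_distr comp_def)
  also have "\<dots> = distr \<mu> \<mu> (\<lambda>x. real_decode (real_code x))"
    unfolding Y by (subst distr_distr) (auto simp: comp_def intro!: distr_cong \<mu>(2)[symmetric])
  also have "\<dots> = \<mu>" by (simp add: real_decode_code distr_id[unfolded id_def])
  finally show ?thesis by (intro bexI[of _ "\<lambda>\<omega>. real_decode (Y \<omega>)"]) auto
qed

section \<open>Realizing laws and conditional laws on the sample space\<close>

text \<open>Null points are the form in which nonatomicity is used; this property passes to
  conditional measures. Inclusion of the Borel sets allows completed measures.\<close>

locale point_null_prob_space = prob_space P for P :: "'w::polish_space measure" +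
  assumes borel_subset: "sets borel \<subseteq> sets P"
    and point_null: "emeasure P {x} = 0"
begin

lemma space_UNIV: "space P = UNIV"
proof -
  have "UNIV \<in> sets P" using borel_subset by (rule subsetD) simp
  from sets.sets_into_space[OF this] show ?thesis by auto
qed

lemma real_code_measurable [measurable]: "real_code \<in> borel_measurable P"
  using borel_measurable_real_code borel_subset space_UNIV
  by (auto simp: measurable_def)

lemma realize:
  fixes \<mu> :: "'b::{banach, second_countable_topology} measure"
  assumes "prob_space \<mu>" "sets \<mu> = sets borel"
  shows "\<exists>Y\<in>borel_measurable P. distr P borel Y = \<mu>"
  by (rule realize_law[OF real_code_measurable]) (use assms point_null inj_real_code in \<open>auto intro: inj_on_subset\<close>)

lemma realize_conditionally:
  fixes \<mu> :: "'b::{banach, second_countable_topology} measure"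
  assumes [measurable]: "A \<in> sets P" and pos: "emeasure P A \<noteq> 0" and \<mu>: "prob_space \<mu>" "sets \<mu> = sets borel"
  shows "\<exists>Y\<in>borel_measurable P. distr (uniform_measure P A) borel Y = \<mu>"
proof -
  interpret A: prob_space "uniform_measure P A"
    using pos by (intro prob_space_uniform_measure) (auto simp: emeasure_eq_measure)
  have "{x} \<in> sets P" for x using borel_subset by auto
  then have "emeasure (uniform_measure P A) {x} = 0" for x
    using emeasure_mono[of "A \<inter> {x}" "{x}" P] point_null[of x] by (simp add: emeasure_uniform_measure)
  moreover have "real_code \<in> borel_measurable (uniform_measure P A)"
    by (simp cong: measurable_cong_sets)
  ultimately have "\<exists>Y\<in>borel_measurable (uniform_measure P A). distr (uniform_measure P A) borel Y = \<mu>"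
    by (intro A.realize_law[of real_code]) (use \<mu> inj_real_code in \<open>auto intro: inj_on_subset\<close>)
  then show ?thesis by (simp cong: measurable_cong_sets)
qed

text \<open>
  For first components that are not discrete this fails: \<open>N'\<close> may then generate all of \<open>sets P\<close> while \<open>N\<close>
  does not.
\<close>

lemma realize_joint_law:
  fixes N N' :: "'w \<Rightarrow> nat" and Y :: "'w \<Rightarrow> 'b::{banach, second_countable_topology}"
  assumes [measurable]: "N \<in> measurable P (count_space UNIV)" "N' \<in> measurable P (count_space UNIV)"
      "Y \<in> borel_measurable P"
    and eq: "distr P (count_space UNIV) N = distr P (count_space UNIV) N'"
  shows "\<exists>Y'\<in>borel_measurable P.
    distr P (count_space UNIV \<Otimes>\<^sub>M borel) (\<lambda>\<omega>. (N' \<omega>, Y' \<omega>)) = distr P (count_space UNIV \<Otimes>\<^sub>M borel) (\<lambda>\<omega>. (N \<omega>, Y \<omega>))"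
proof -
  define A where "A i = {\<omega>\<in>space P. N \<omega> = i}" for i
  define A' where "A' i = {\<omega>\<in>space P. N' \<omega> = i}" for i
  have [measurable]: "A i \<in> sets P" "A' i \<in> sets P" for i
    unfolding A_def A'_def by measurable
  have AA': "emeasure P (A i) = emeasure P (A' i)" for i
  proof -
    have "emeasure (distr P (count_space UNIV) N) {i} = emeasure (distr P (count_space UNIV) N') {i}"
      by (simp add: eq)
    then show ?thesis by (simp add: emeasure_distr A_def A'_def vimage_def Int_def conj_commute)
  qed
  \<comment> \<open>On each fibre of \<open>N'\<close> one realizes the conditional law of
    \<open>Y\<close> given the corresponding fibre of \<open>N\<close>; null fibres get the constant
    0. Multiplying by the common mass removes the conditioning.\<close>
  have "\<exists>U\<in>borel_measurable P. \<forall>S\<in>sets borel.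
      emeasure P (A' i \<inter> (U -` S \<inter> space P)) = emeasure P (A i \<inter> (Y -` S \<inter> space P))" for i
  proof (cases "emeasure P (A i) = 0")
    case True
    have "emeasure P (B \<inter> C) = 0" if "emeasure P B = 0" "B \<in> sets P" for B C
      using emeasure_mono[of "B \<inter> C" B P] that by simp
    then show ?thesis using True AA'[of i] by (intro bexI[of _ "\<lambda>_. 0"]) auto
  next
    case False
    have [measurable]: "Y \<in> borel_measurable (uniform_measure P (A i))"
      by (simp cong: measurable_cong_sets)
    interpret Ai: prob_space "uniform_measure P (A i)"
      using False by (intro prob_space_uniform_measure) (auto simp: emeasure_eq_measure)
    have "prob_space (distr (uniform_measure P (A i)) borel Y)"
      by (rule Ai.prob_space_distr) simp
    with False AA'[of i] obtain U where U: "U \<in> borel_measurable P"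
      "distr (uniform_measure P (A' i)) borel U = distr (uniform_measure P (A i)) borel Y"
      using realize_conditionally[of "A' i" "distr (uniform_measure P (A i)) borel Y"] by auto
    note [measurable] = U(1)
    have "emeasure P (A' i \<inter> (U -` S \<inter> space P)) = emeasure P (A i \<inter> (Y -` S \<inter> space P))"
      if [measurable]: "S \<in> sets borel" for S
    proof -
      have "emeasure P (A' i \<inter> (U -` S \<inter> space P)) / emeasure P (A' i)
        = emeasure (distr (uniform_measure P (A' i)) borel U) S"
        by (subst emeasure_distr) (simp_all add: emeasure_uniform_measure cong: measurable_cong_sets)
      also have "\<dots> = emeasure P (A i \<inter> (Y -` S \<inter> space P)) / emeasure P (A i)"
        unfolding U(2) by (subst emeasure_distr) (simp_all add: emeasure_uniform_measure cong: measurable_cong_sets)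
      finally show ?thesis
        using False AA'[of i] by (simp add: emeasure_eq_measure divide_ennreal zero_less_measure_iff)
    qed
    with U(1) show ?thesis by blast
  qed
  then obtain U where U [measurable]: "\<And>i. U i \<in> borel_measurable P"
    and UY: "\<And>i S. S \<in> sets borel \<Longrightarrow>
      emeasure P (A' i \<inter> (U i -` S \<inter> space P)) = emeasure P (A i \<inter> (Y -` S \<inter> space P))"
    by metis
  \<comment> \<open>Gluing over the fibres stays measurable because there are countably
    many.\<close>
  let ?Y' = "\<lambda>\<omega>. U (N' \<omega>) \<omega>"
  have [measurable]: "?Y' \<in> borel_measurable P"
    by (rule measurable_compose_countable) measurable
  have split: "emeasure (distr P (count_space UNIV \<Otimes>\<^sub>M borel) (\<lambda>\<omega>. (K \<omega>, W \<omega>))) S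
      = (\<Sum>i. emeasure P ({\<omega>\<in>space P. K \<omega> = i} \<inter> (W -` (Pair i -` S) \<inter> space P)))"
    if [measurable]: "K \<in> measurable P (count_space UNIV)" "W \<in> borel_measurable P" "S \<in> sets (count_space UNIV \<Otimes>\<^sub>M borel)"
    for K :: "'w \<Rightarrow> nat" and W :: "'w \<Rightarrow> 'b" and S
  proof -
    have "(\<Sum>i. emeasure P ({\<omega>\<in>space P. K \<omega> = i} \<inter> (W -` (Pair i -` S) \<inter> space P)))
       = emeasure P (\<Union>i. {\<omega>\<in>space P. K \<omega> = i} \<inter> (W -` (Pair i -` S) \<inter> space P))"
      by (rule suminf_emeasure) (auto simp: disjoint_family_on_def)
    also have "(\<Union>i. {\<omega>\<in>space P. K \<omega> = i} \<inter> (W -` (Pair i -` S) \<inter> space P)) = (\<lambda>\<omega>. (K \<omega>, W \<omega>)) -` S \<inter> space P"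
      by auto
    finally show ?thesis by (subst emeasure_distr) auto
  qed
  have "distr P (count_space UNIV \<Otimes>\<^sub>M borel) (\<lambda>\<omega>. (N' \<omega>, ?Y' \<omega>)) = distr P (count_space UNIV \<Otimes>\<^sub>M borel) (\<lambda>\<omega>. (N \<omega>, Y \<omega>))"
  proof (rule measure_eqI)
    fix S assume "S \<in> sets (distr P (count_space UNIV \<Otimes>\<^sub>M borel) (\<lambda>\<omega>. (N' \<omega>, ?Y' \<omega>)))"
    then have S [measurable]: "S \<in> sets (count_space UNIV \<Otimes>\<^sub>M borel)" by simp
    have "{\<omega>\<in>space P. N' \<omega> = i} \<inter> (?Y' -` (Pair i -` S) \<inter> space P) = A' i \<inter> (U i -` (Pair i -` S) \<inter> space P)" for i
      by (auto simp: A'_def)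
    moreover have "Pair i -` S \<in> sets borel" for i
      using S by (rule sets_Pair1)
    ultimately show "emeasure (distr P (count_space UNIV \<Otimes>\<^sub>M borel) (\<lambda>\<omega>. (N' \<omega>, ?Y' \<omega>))) S
        = emeasure (distr P (count_space UNIV \<Otimes>\<^sub>M borel) (\<lambda>\<omega>. (N \<omega>, Y \<omega>))) S"
      by (simp add: split UY) (simp add: A_def)
  qed simp
  then show ?thesis by (intro bexI[of _ ?Y']) auto
qed

end

section \<open>Wasserstein space and lifts\<close>

lemma borel_measurable_fst_borel [measurable]:
  "fst \<in> borel_measurable (borel :: ('a::second_countable_topology \<times> 'b::second_countable_topology) measure)"
  unfolding borel_prod[symmetric] by measurable

lemma borel_measurable_snd_borel [measurable]:
  "snd \<in> borel_measurable (borel :: ('a::second_countable_topology \<times> 'b::second_countable_topology) measure)"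
  unfolding borel_prod[symmetric] by measurable

lemma L2_space_law:
  assumes "X \<in> L2_space M" and [measurable]: "Y \<in> borel_measurable N"
    and eq: "distr N borel Y = distr M borel X"
  shows "Y \<in> L2_space N"
proof (rule L2_spaceI)
  note [measurable] = assms(1)[THEN borel_measurable_L2]
  have "integrable (distr M borel X) (\<lambda>x. (norm x)\<^sup>2)"
    using integrable_L2_norm_sq[OF assms(1)] by (subst integrable_distr_eq) auto
  then show "integrable N (\<lambda>\<omega>. (norm (Y \<omega>))\<^sup>2)"
    unfolding eq[symmetric] by (subst (asm) integrable_distr_eq) auto
qed fact

lemma (in prob_space) distr_in_P2:
  assumes X: "X \<in> L2_space M"
  shows "distr M borel X \<in> P2"
proof -
  note [measurable] = X[THEN borel_measurable_L2]
  have "integrable (distr M borel X) (\<lambda>x. (norm x)\<^sup>2)"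
    using integrable_L2_norm_sq[OF X] by (subst integrable_distr_eq) auto
  then show ?thesis by (simp add: P2_def prob_space_distr)
qed

lemma L2_space_of_P2:
  assumes [measurable]: "X \<in> borel_measurable M" and "distr M borel X \<in> P2"
  shows "X \<in> L2_space M"
  using assms by (intro L2_spaceI) (auto simp: P2_def integrable_distr_eq)

lemma (in prob_space) distr_Pair_in_couplings:
  assumes X: "X \<in> L2_space M" and Y: "Y \<in> L2_space M"
  shows "distr M borel (\<lambda>\<omega>. (X \<omega>, Y \<omega>)) \<in> couplings (distr M borel X) (distr M borel Y)"
proof -
  note [measurable] = X[THEN borel_measurable_L2] Y[THEN borel_measurable_L2]
  have "(\<lambda>\<omega>. (X \<omega>, Y \<omega>)) \<in> borel_measurable M" by measurable
  then show ?thesis by (simp add: couplings_def prob_space_distr distr_distr comp_def)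
qed

lemma integral_dist_sq_distr_Pair:
  assumes X: "X \<in> L2_space M" and Y: "Y \<in> L2_space M"
  shows "(\<integral>p. (dist (fst p) (snd p))\<^sup>2 \<partial>distr M borel (\<lambda>\<omega>. (X \<omega>, Y \<omega>))) = (L2_dist M X Y)\<^sup>2"
proof -
  note [measurable] = X[THEN borel_measurable_L2] Y[THEN borel_measurable_L2]
  have "(\<lambda>\<omega>. (X \<omega>, Y \<omega>)) \<in> borel_measurable M" by measurable
  then show ?thesis by (simp add: integral_distr L2_norm_def dist_norm)
qed

lemma bdd_below_transport_cost:
  "bdd_below ((\<lambda>\<gamma>. \<integral>p. (dist (fst p) (snd p))\<^sup>2 \<partial>\<gamma>) ` couplings \<mu> \<nu>)"
  by (rule bdd_belowI2[of _ 0]) simp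

text \<open>The joint law of \<open>X\<close> and \<open>Y\<close> is an admissible
  coupling.\<close>

lemma (in prob_space) W2_distr_le:
  assumes "X \<in> L2_space M" "Y \<in> L2_space M"
  shows "W2 (distr M borel X) (distr M borel Y) \<le> L2_dist M X Y"
proof -
  have "(INF \<gamma>\<in>couplings (distr M borel X) (distr M borel Y). \<integral>p. (dist (fst p) (snd p))\<^sup>2 \<partial>\<gamma>) \<le> (L2_dist M X Y)\<^sup>2"
    using cINF_lower[OF bdd_below_transport_cost distr_Pair_in_couplings[OF assms]]
    by (simp add: integral_dist_sq_distr_Pair[OF assms])
  then show ?thesis
    unfolding W2_def by (rule real_le_lsqrt[rotated -1]) simp
qed

lemma distr_convex_combination:
  assumes X: "X \<in> L2_space M" and Y: "Y \<in> L2_space M"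
  shows "distr (distr M borel (\<lambda>\<omega>. (X \<omega>, Y \<omega>))) borel (\<lambda>p. (1 - t) *\<^sub>R fst p + t *\<^sub>R snd p)
    = distr M borel (\<lambda>\<omega>. (1 - t) *\<^sub>R X \<omega> + t *\<^sub>R Y \<omega>)"
proof -
  note [measurable] = X[THEN borel_measurable_L2] Y[THEN borel_measurable_L2]
  have "(\<lambda>\<omega>. (X \<omega>, Y \<omega>)) \<in> borel_measurable M" by measurable
  then show ?thesis by (subst distr_distr) (auto simp: comp_def)
qed

section \<open>Transfer between the Wasserstein space and random variables\<close>

context point_null_prob_space
begin

lemma realize_P2:
  assumes "\<mu> \<in> P2"
  obtains X where "X \<in> L2_space P" "distr P borel X = \<mu>"
proof -
  obtain X where "X \<in> borel_measurable P" "distr P borel X = \<mu>"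
    using realize[of \<mu>] assms by (auto simp: P2_def)
  then show ?thesis using assms L2_space_of_P2[of X P] that by blast
qed

text \<open>The plan is realized as one random variable on the product, whose components are then
  taken.\<close>

lemma realize_coupling:
  assumes \<mu>: "\<mu> \<in> P2" and \<nu>: "\<nu> \<in> P2" and \<gamma>: "\<gamma> \<in> couplings \<mu> \<nu>"
  obtains X Y where "X \<in> L2_space P" "Y \<in> L2_space P" "distr P borel X = \<mu>" "distr P borel Y = \<nu>"
    "distr P borel (\<lambda>\<omega>. (X \<omega>, Y \<omega>)) = \<gamma>"
proof -
  obtain Z where [measurable]: "Z \<in> borel_measurable P" and Z: "distr P borel Z = \<gamma>"
    using realize[of \<gamma>] \<gamma> by (auto simp: couplings_def)
  have eq: "distr P borel (\<lambda>\<omega>. fst (Z \<omega>)) = \<mu>" "distr P borel (\<lambda>\<omega>. snd (Z \<omega>)) = \<nu>"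
    using \<gamma> unfolding couplings_def Z[symmetric] by (auto simp: distr_distr comp_def)
  show ?thesis
    by (rule that[of "\<lambda>\<omega>. fst (Z \<omega>)" "\<lambda>\<omega>. snd (Z \<omega>)"]) (use \<mu> \<nu> eq Z in \<open>auto intro!: L2_space_of_P2\<close>)
qed

text \<open>Ensures that the real infimum in \<open>W2\<close> has its intended value.\<close>

lemma couplings_nonempty:
  assumes "\<mu> \<in> P2" "\<nu> \<in> P2"
  shows "couplings \<mu> \<nu> \<noteq> {}"
proof -
  obtain X where "X \<in> L2_space P" "distr P borel X = \<mu>" using assms(1) by (rule realize_P2)
  moreover obtain Y where "Y \<in> L2_space P" "distr P borel Y = \<nu>" using assms(2) by (rule realize_P2)
  ultimately show ?thesis using distr_Pair_in_couplings[of X Y] by auto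
qed

lemma W2_nonneg: "\<mu> \<in> P2 \<Longrightarrow> \<nu> \<in> P2 \<Longrightarrow> 0 \<le> W2 \<mu> \<nu>"
  unfolding W2_def using couplings_nonempty by (auto intro!: cINF_greatest)

text \<open>The best constant is attained: dividing by \<open>W2\<close> makes it an infimum of
  upper bounds. At distance zero any bound already forces equal values.\<close>

lemma P2_lip_bound_P2_Lip:
  assumes "P2_lipschitz G"
  shows "P2_lip_bound G (P2_Lip G)"
  unfolding P2_lip_bound_def
proof (intro conjI ballI)
  have ne: "{L. P2_lip_bound G L} \<noteq> {}"
    using assms by (auto simp: P2_lipschitz_def)
  show "0 \<le> P2_Lip G"
    unfolding P2_Lip_def using ne by (rule cInf_greatest) (simp add: P2_lip_bound_def)
  fix \<mu> \<nu> :: "'a measure" assume \<mu>: "\<mu> \<in> P2" and \<nu>: "\<nu> \<in> P2"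
  have le: "\<bar>G \<mu> - G \<nu>\<bar> \<le> L * W2 \<mu> \<nu>" if "P2_lip_bound G L" for L
    using that \<mu> \<nu> by (simp add: P2_lip_bound_def)
  show "\<bar>G \<mu> - G \<nu>\<bar> \<le> P2_Lip G * W2 \<mu> \<nu>"
  proof (cases "W2 \<mu> \<nu> = 0")
    case True
    then show ?thesis using le ne by auto
  next
    case False
    with W2_nonneg[OF \<mu> \<nu>] have W: "0 < W2 \<mu> \<nu>" by simp
    have "\<bar>G \<mu> - G \<nu>\<bar> / W2 \<mu> \<nu> \<le> P2_Lip G"
      unfolding P2_Lip_def using ne by (rule cInf_greatest) (use le W in \<open>simp add: pos_divide_le_eq\<close>)
    then show ?thesis using W by (simp add: pos_divide_le_eq)
  qed
qed

text \<open>The discretizations of \<open>X\<close> and \<open>X'\<close> have the same law, so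
  \<open>Y\<close> can be rearranged with its joint law preserved exactly. Returning to
  \<open>X\<close> and \<open>X'\<close> costs half of \<open>\<delta>\<close> each.\<close>

lemma rearrange_L2:
  fixes X X' Y :: "'w \<Rightarrow> 'a::euclidean_space"
  assumes X: "X \<in> L2_space P" and X': "X' \<in> L2_space P" and Y: "Y \<in> L2_space P"
    and eq: "distr P borel X = distr P borel X'" and \<delta>: "0 < \<delta>"
  shows "\<exists>Y'\<in>L2_space P. distr P borel Y' = distr P borel Y \<and> L2_dist P X' Y' \<le> L2_dist P X Y + \<delta>"
proof -
  note [measurable] = X[THEN borel_measurable_L2] X'[THEN borel_measurable_L2] Y[THEN borel_measurable_L2]
  \<comment> \<open>The index is kept instead of the nearby dense point, so that the first component
    takes values in \<open>nat\<close> as \<open>realize_joint_law\<close> demands.\<close>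
  define n where "n x = (LEAST i. dist x (dense_seq i) < \<delta> / 2)" for x :: 'a
  have [measurable]: "n \<in> measurable borel (count_space UNIV)"
    unfolding n_def by measurable
  define q where "q x = (dense_seq (n x) :: 'a)" for x
  have [measurable]: "q \<in> borel_measurable borel"
    unfolding q_def by measurable
  have q: "norm (x - q x) < \<delta> / 2" for x
    using LeastI_ex[OF dense_seq[of "\<delta> / 2" x]] \<delta> by (simp add: q_def n_def dist_norm)
  have qL2: "(\<lambda>\<omega>. q (W \<omega>)) \<in> L2_space P" "L2_dist P W (\<lambda>\<omega>. q (W \<omega>)) \<le> \<delta> / 2"
    if W: "W \<in> L2_space P" for W
  proof -
    note [measurable] = W[THEN borel_measurable_L2]
    show "(\<lambda>\<omega>. q (W \<omega>)) \<in> L2_space P"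
      by (rule L2_space_bounded_dist[OF W, where c="\<delta> / 2"]) (use q in \<open>auto intro: less_imp_le\<close>)
    show "L2_dist P W (\<lambda>\<omega>. q (W \<omega>)) \<le> \<delta> / 2"
      by (rule L2_norm_le_bound) (use q in \<open>auto intro: less_imp_le\<close>)
  qed
  have "distr P (count_space UNIV) (\<lambda>\<omega>. n (X \<omega>)) = distr (distr P borel X) (count_space UNIV) n"
    by (simp add: distr_distr comp_def)
  also have "\<dots> = distr P (count_space UNIV) (\<lambda>\<omega>. n (X' \<omega>))"
    by (simp add: eq distr_distr comp_def)
  finally obtain Y' where [measurable]: "Y' \<in> borel_measurable P" and
    joint: "distr P (count_space UNIV \<Otimes>\<^sub>M borel) (\<lambda>\<omega>. (n (X' \<omega>), Y' \<omega>)) = distr P (count_space UNIV \<Otimes>\<^sub>M borel) (\<lambda>\<omega>. (n (X \<omega>), Y \<omega>))"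
    using realize_joint_law[of "\<lambda>\<omega>. n (X \<omega>)" "\<lambda>\<omega>. n (X' \<omega>)" Y] by auto
  have law: "distr P borel Y' = distr P borel Y"
  proof -
    have *: "distr P borel W = distr (distr P (count_space UNIV \<Otimes>\<^sub>M borel) (\<lambda>\<omega>. (n (V \<omega>), W \<omega>))) borel snd"
      if [measurable]: "V \<in> borel_measurable P" "W \<in> borel_measurable P" for V W :: "'w \<Rightarrow> 'a"
      by (subst distr_distr) (auto simp: comp_def)
    show ?thesis unfolding *[of X' Y', simplified] *[of X Y, simplified] joint ..
  qed
  have Y': "Y' \<in> L2_space P" by (rule L2_space_law[OF Y _ law]) simp
  have "L2_dist P (\<lambda>\<omega>. q (X' \<omega>)) Y' = L2_dist P (\<lambda>\<omega>. q (X \<omega>)) Y"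
  proof -
    have [measurable]: "(\<lambda>p. (norm (dense_seq (fst p) - snd p :: 'a))\<^sup>2) \<in> borel_measurable (count_space UNIV \<Otimes>\<^sub>M borel)"
      by measurable
    have *: "L2_dist P (\<lambda>\<omega>. q (V \<omega>)) W = sqrt (\<integral>p. (norm (dense_seq (fst p) - snd p))\<^sup>2
        \<partial>distr P (count_space UNIV \<Otimes>\<^sub>M borel) (\<lambda>\<omega>. (n (V \<omega>), W \<omega>)))"
      if [measurable]: "V \<in> borel_measurable P" "W \<in> borel_measurable P" for V W :: "'w \<Rightarrow> 'a"
      by (subst integral_distr) (auto simp: L2_norm_def q_def)
    show ?thesis using *[of X' Y'] *[of X Y] joint by simp
  qed
  moreover have "L2_dist P X' Y' \<le> L2_dist P X' (\<lambda>\<omega>. q (X' \<omega>)) + L2_dist P (\<lambda>\<omega>. q (X' \<omega>)) Y'"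
    using X' Y' qL2 by (intro L2_norm_triangle_diff) auto
  moreover have "L2_dist P (\<lambda>\<omega>. q (X \<omega>)) Y \<le> L2_dist P (\<lambda>\<omega>. q (X \<omega>)) X + L2_dist P X Y"
    using X Y qL2 by (intro L2_norm_triangle_diff) auto
  ultimately have "L2_dist P X' Y' \<le> L2_dist P X Y + \<delta>"
    using qL2(2)[OF X] qL2(2)[OF X'] L2_norm_minus_commute[of P X "\<lambda>\<omega>. q (X \<omega>)"] by linarith
  with Y' law show ?thesis by blast
qed

lemma law_invariant_functional_lift:
  fixes G :: "'a::euclidean_space measure \<Rightarrow> real"
  assumes "0 < \<epsilon>" and G: "P2_lip_bound G L"
  shows "law_invariant_functional P (lift P G) L \<epsilon>"
proof unfold_locales
  show "0 \<le> L" using G by (simp add: P2_lip_bound_def)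
  show "0 < \<epsilon>" by fact
  show "\<bar>lift P G X - lift P G Y\<bar> \<le> L * L2_dist P X Y" if X: "X \<in> L2_space P" and Y: "Y \<in> L2_space P" for X Y
  proof -
    have "\<bar>lift P G X - lift P G Y\<bar> \<le> L * W2 (distr P borel X) (distr P borel Y)"
      using G distr_in_P2[OF X] distr_in_P2[OF Y] by (simp add: P2_lip_bound_def lift_def)
    also have "\<dots> \<le> L * L2_dist P X Y"
      using W2_distr_le[OF X Y] \<open>0 \<le> L\<close> by (rule mult_left_mono)
    finally show ?thesis .
  qed
  show "lift P G X = lift P G Y" if "distr P borel X = distr P borel Y" for X Y
    using that by (simp add: lift_def)
qed (rule rearrange_L2)

lemma lift_convex:
  fixes X Y :: "'w \<Rightarrow> 'a::euclidean_space"
  assumes G: "convex_along_plans G" and t: "t \<in> {0..1}" and X: "X \<in> L2_space P" and Y: "Y \<in> L2_space P"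
  shows "lift P G (\<lambda>\<omega>. (1 - t) *\<^sub>R X \<omega> + t *\<^sub>R Y \<omega>) \<le> (1 - t) * lift P G X + t * lift P G Y"
  using G distr_in_P2[OF X] distr_in_P2[OF Y] distr_Pair_in_couplings[OF X Y] t
  unfolding convex_along_plans_def lift_def distr_convex_combination[OF X Y, symmetric] by blast

end

context law_invariant_functional
begin

text \<open>Invariance in law supplies the uniqueness behind \<open>THE\<close>.\<close>

lemma P2_lasry_lions_distr:
  assumes V: "V = lift P G" and X: "X \<in> L2_space P"
  shows "P2_lasry_lions P \<epsilon> G (distr P borel X) = lasry_lions P \<epsilon> (lift P G) X"
  unfolding P2_lasry_lions_def
proof (rule the_equality)
  show "r = lasry_lions P \<epsilon> (lift P G) X"
    if "\<exists>Y\<in>L2_space P. distr P borel Y = distr P borel X \<and> r = lasry_lions P \<epsilon> (lift P G) Y" for r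
  proof -
    from that obtain Y where "Y \<in> L2_space P" "distr P borel Y = distr P borel X" "r = lasry_lions P \<epsilon> (lift P G) Y"
      by blast
    then show ?thesis using lasry_lions_law_invariant[OF _ X, of Y] by (simp add: V)
  qed
qed (use X in blast)

end

lemma (in prob_space) point_null_of_nonatomic:
  assumes "nonatomic M" and x: "{x} \<in> sets M"
  shows "emeasure M {x} = 0"
proof (rule ccontr)
  assume "emeasure M {x} \<noteq> 0"
  then have "0 < emeasure M {x}" by (simp add: zero_less_iff_neq_zero)
  then obtain B where "B \<subseteq> {x}" "0 < emeasure M B" "emeasure M B < emeasure M {x}"
    using assms unfolding nonatomic_def by blast
  then show False by (cases "B = {}") (auto simp: subset_singleton_iff)
qed

theorem proposition5p2:
  fixes P :: "'w::polish_space measure"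
    and G :: "(real ^ 'd) measure \<Rightarrow> real"
    and \<epsilon> :: real
  assumes "prob_space P"
    and "complete_measure P"
    and "space P = UNIV"
    and "sets borel \<subseteq> sets P"
    and "nonatomic P"
    and "0 < \<epsilon>"
    and "P2_lipschitz G"
  shows "(\<forall>X\<in>L2_space P. \<forall>Y\<in>L2_space P. distr P borel X = distr P borel Y \<longrightarrow>
            lasry_lions P \<epsilon> (lift P G) X = lasry_lions P \<epsilon> (lift P G) Y)
       \<and> (\<forall>\<mu>\<in>P2. \<exists>!r. \<exists>X\<in>L2_space P. distr P borel X = \<mu> \<and> r = lasry_lions P \<epsilon> (lift P G) X)
       \<and> P2_C11 P (P2_lasry_lions P \<epsilon> G)
       \<and> P2_lipschitz (P2_lasry_lions P \<epsilon> G)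
       \<and> P2_Lip (P2_lasry_lions P \<epsilon> G) \<le> P2_Lip G
       \<and> (\<forall>\<mu>\<in>P2. 0 \<le> P2_lasry_lions P \<epsilon> G \<mu> - G \<mu>
               \<and> P2_lasry_lions P \<epsilon> G \<mu> - G \<mu> \<le> (P2_Lip G)\<^sup>2 / 2 * \<epsilon>)
       \<and> (convex_along_plans G \<longrightarrow> convex_along_plans (P2_lasry_lions P \<epsilon> G))"
proof -
  interpret prob_space P by fact
  interpret point_null_prob_space P
  proof unfold_locales
    show "sets borel \<subseteq> sets P" by fact
    fix x
    have "{x} \<in> sets P" using \<open>sets borel \<subseteq> sets P\<close> by (rule subsetD) simp
    with \<open>nonatomic P\<close> show "emeasure P {x} = 0" by (rule point_null_of_nonatomic)
  qed
  let ?L = "P2_Lip G" and ?LL = "lasry_lions P \<epsilon> (lift P G)" and ?G = "P2_lasry_lions P \<epsilon> G"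
  \<comment> \<open>Taking the best constant for \<open>L\<close> yields the bounds directly in
    terms of \<open>P2_Lip G\<close>.\<close>
  interpret F: law_invariant_functional P "lift P G" ?L \<epsilon>
    by (rule law_invariant_functional_lift[OF assms(6) P2_lip_bound_P2_Lip[OF assms(7)]])
  have distr: "?G (distr P borel X) = ?LL X" if "X \<in> L2_space P" for X
    by (rule F.P2_lasry_lions_distr[OF refl that])
  have unique: "\<exists>!r. \<exists>X\<in>L2_space P. distr P borel X = \<mu> \<and> r = ?LL X" if \<mu>: "\<mu> \<in> P2" for \<mu>
  proof -
    obtain X where X: "X \<in> L2_space P" "distr P borel X = \<mu>" using \<mu> by (rule realize_P2)
    show ?thesis
    proof (rule ex1I[of _ "?LL X"])
      show "\<exists>Y\<in>L2_space P. distr P borel Y = \<mu> \<and> ?LL X = ?LL Y" using X by blast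
      show "r = ?LL X" if "\<exists>Y\<in>L2_space P. distr P borel Y = \<mu> \<and> r = ?LL Y" for r
      proof -
        from that obtain Y where "Y \<in> L2_space P" "distr P borel Y = \<mu>" "r = ?LL Y" by blast
        then show ?thesis using distr[of Y] distr[OF X(1)] X(2) by simp
      qed
    qed
  qed
  have bound: "P2_lip_bound ?G ?L"
    unfolding P2_lip_bound_def
  proof (intro conjI ballI)
    show "0 \<le> ?L" by (rule F.L_nonneg)
    fix \<mu> \<nu> :: "(real ^ 'd) measure" assume \<mu>: "\<mu> \<in> P2" and \<nu>: "\<nu> \<in> P2"
    \<comment> \<open>Every plan is realized by a pair, so its cost bounds the increment. Squares
      are compared because \<open>W2\<close> is the root of an infimum.\<close>
    have sq_le: "(\<bar>?G \<mu> - ?G \<nu>\<bar>)\<^sup>2 \<le> ?L\<^sup>2 * (\<integral>p. (dist (fst p) (snd p))\<^sup>2 \<partial>\<gamma>)" if \<gamma>: "\<gamma> \<in> couplings \<mu> \<nu>" for \<gamma>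
    proof -
      obtain X Y where X: "X \<in> L2_space P" and Y: "Y \<in> L2_space P"
        and "distr P borel X = \<mu>" "distr P borel Y = \<nu>" and XY: "distr P borel (\<lambda>\<omega>. (X \<omega>, Y \<omega>)) = \<gamma>"
        using \<mu> \<nu> \<gamma> by (rule realize_coupling)
      then have "\<bar>?G \<mu> - ?G \<nu>\<bar> \<le> ?L * L2_dist P X Y"
        using F.lasry_lions_Lip[OF X Y] distr[OF X] distr[OF Y] by simp
      then have "(\<bar>?G \<mu> - ?G \<nu>\<bar>)\<^sup>2 \<le> (?L * L2_dist P X Y)\<^sup>2"
        by (rule power_mono) simp
      then show ?thesis
        using integral_dist_sq_distr_Pair[OF X Y] XY by (simp add: power_mult_distrib)
    qed
    show "\<bar>?G \<mu> - ?G \<nu>\<bar> \<le> ?L * W2 \<mu> \<nu>"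
    \<comment> \<open>For positive \<open>?L\<close> the constant is divided out before the infimum
      over plans is taken.\<close>
    proof (cases "?L = 0")
      case True
      then show ?thesis using sq_le couplings_nonempty[OF \<mu> \<nu>] by fastforce
    next
      case False
      then have L: "0 < ?L" using F.L_nonneg by simp
      have "(\<bar>?G \<mu> - ?G \<nu>\<bar> / ?L)\<^sup>2 \<le> (INF \<gamma>\<in>couplings \<mu> \<nu>. \<integral>p. (dist (fst p) (snd p))\<^sup>2 \<partial>\<gamma>)"
        using couplings_nonempty[OF \<mu> \<nu>]
      proof (rule cINF_greatest)
        fix \<gamma> assume "\<gamma> \<in> couplings \<mu> \<nu>"
        from sq_le[OF this] show "(\<bar>?G \<mu> - ?G \<nu>\<bar> / ?L)\<^sup>2 \<le> (\<integral>p. (dist (fst p) (snd p))\<^sup>2 \<partial>\<gamma>)"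
          using L by (simp add: power_divide pos_divide_le_eq mult.commute)
      qed
      then have "\<bar>?G \<mu> - ?G \<nu>\<bar> / ?L \<le> W2 \<mu> \<nu>"
        unfolding W2_def by (rule real_le_rsqrt)
      then show ?thesis using L by (simp add: pos_divide_le_eq mult.commute)
    qed
  qed
  have lip: "P2_lipschitz ?G" using bound by (auto simp: P2_lipschitz_def)
  have Lip_le: "P2_Lip ?G \<le> ?L"
    unfolding P2_Lip_def[of ?G] using bound
    by (intro cInf_lower bdd_belowI[of _ 0]) (auto simp: P2_lip_bound_def)
  have C11: "P2_C11 P ?G"
    unfolding P2_C11_def by (rule F.L2_C11_lasry_lions) (simp add: lift_def[of P ?G] distr)
  have close: "0 \<le> ?G \<mu> - G \<mu> \<and> ?G \<mu> - G \<mu> \<le> ?L\<^sup>2 / 2 * \<epsilon>" if \<mu>: "\<mu> \<in> P2" for \<mu>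
  proof -
    obtain X where X: "X \<in> L2_space P" "distr P borel X = \<mu>" using \<mu> by (rule realize_P2)
    then show ?thesis
      using F.lasry_lions_ge[OF X(1)] F.lasry_lions_upper[OF X(1)] distr[OF X(1)] by (simp add: lift_def[of P G])
  qed
  have convex: "convex_along_plans ?G" if G: "convex_along_plans G"
    unfolding convex_along_plans_def
  proof (intro ballI)
    fix \<mu> \<nu> :: "(real ^ 'd) measure" and \<gamma> and t :: real
    assume \<mu>\<nu>: "\<mu> \<in> P2" "\<nu> \<in> P2" "\<gamma> \<in> couplings \<mu> \<nu>" and t: "t \<in> {0..1}"
    \<comment> \<open>Realizing the plan turns convexity along it into linear convexity in the space
      of random variables.\<close>
    from \<mu>\<nu> obtain X Y where X: "X \<in> L2_space P" and Y: "Y \<in> L2_space P"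
      and laws: "distr P borel X = \<mu>" "distr P borel Y = \<nu>" "distr P borel (\<lambda>\<omega>. (X \<omega>, Y \<omega>)) = \<gamma>"
      by (rule realize_coupling)
    have "?LL (\<lambda>\<omega>. (1 - t) *\<^sub>R X \<omega> + t *\<^sub>R Y \<omega>) \<le> (1 - t) * ?LL X + t * ?LL Y"
      by (rule F.lasry_lions_convex[OF lift_convex[OF G t] t X Y])
    moreover have "?G (distr \<gamma> borel (\<lambda>p. (1 - t) *\<^sub>R fst p + t *\<^sub>R snd p)) = ?LL (\<lambda>\<omega>. (1 - t) *\<^sub>R X \<omega> + t *\<^sub>R Y \<omega>)"
      using distr_convex_combination[OF X Y, of t] distr[OF L2_space_convex[OF X Y, of t]] laws(3) by simp
    moreover have "?G \<mu> = ?LL X" "?G \<nu> = ?LL Y"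
      using distr[OF X] distr[OF Y] laws(1,2) by simp_all
    ultimately show "?G (distr \<gamma> borel (\<lambda>p. (1 - t) *\<^sub>R fst p + t *\<^sub>R snd p)) \<le> (1 - t) * ?G \<mu> + t * ?G \<nu>"
      by simp
  qed
  show ?thesis
    by (intro conjI ballI[OF unique] ballI[OF close] impI[OF convex] C11 lip Lip_le)
       (intro ballI impI F.lasry_lions_law_invariant)
qed

end
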